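(* Every finite partial Steiner triple system $(U,\mathcal{A})$ is embedded in some finite Steiner triple system $(V,\mathcal{B})$ such that every nontrivial proper subsystem of $(V,\mathcal{B})$ is a subsystem of $(U,\mathcal{A})$.
   Context: A partial Steiner triple system is a pair $(U,\mathcal{A})$ with $\mathcal{A}$ a set of 3-subsets (blocks) of $U$ such that every pair of points lies in at most one block; it is a (complete) Steiner triple system if every pair lies in exactly one block. Its order is $|U|$. $(U',\mathcal{A}')$ is embedded in $(U,\mathcal{A})$ if $U'\subseteq U$ and $\mathcal{A}'\subseteq\mathcal{A}$. A subsystem of a partial Steiner triple system $(U,\mathcal{A})$ is a complete Steiner triple system $(U',\mathcal{A}')$ embedded in it; it is proper if $U'\neq U$ and nontrivial if $|U'|>3$. *)

theory Defs
  imports Main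
begin

text \<open>A system is given by its point set and its block set; the points live in an ambient type.\<close>

definition partial_sts :: "'a set \<Rightarrow> 'a set set \<Rightarrow> bool" where
  "partial_sts U A \<longleftrightarrow>
     (\<forall>b\<in>A. b \<subseteq> U \<and> card b = 3) \<and>
     (\<forall>x\<in>U. \<forall>y\<in>U. x \<noteq> y \<longrightarrow> (\<exists>\<^sub>\<le>\<^sub>1 b. b \<in> A \<and> {x, y} \<subseteq> b))"

definition sts :: "'a set \<Rightarrow> 'a set set \<Rightarrow> bool" where
  "sts U A \<longleftrightarrow>
     partial_sts U A \<and>
     (\<forall>x\<in>U. \<forall>y\<in>U. x \<noteq> y \<longrightarrow> (\<exists>!b. b \<in> A \<and> {x, y} \<subseteq> b))"

definition embedded :: "'a set \<Rightarrow> 'a set set \<Rightarrow> 'a set \<Rightarrow> 'a set set \<Rightarrow> bool" where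
  "embedded U' A' U A \<longleftrightarrow> U' \<subseteq> U \<and> A' \<subseteq> A"

definition subsystem :: "'a set \<Rightarrow> 'a set set \<Rightarrow> 'a set \<Rightarrow> 'a set set \<Rightarrow> bool" where
  "subsystem U' A' U A \<longleftrightarrow> sts U' A' \<and> embedded U' A' U A"

definition proper_subsystem :: "'a set \<Rightarrow> 'a set set \<Rightarrow> 'a set \<Rightarrow> 'a set set \<Rightarrow> bool" where
  "proper_subsystem U' A' U A \<longleftrightarrow> subsystem U' A' U A \<and> U' \<noteq> U"

text \<open>Only meant for finite point sets: \<open>card\<close> is \<open>0\<close> on infinite sets.\<close>

definition nontrivial :: "'a set \<Rightarrow> bool" where
  "nontrivial U \<longleftrightarrow> card U > 3"

end

theory Submission
  imports Defs
begin

text \<open>Doubling a system on \<open>n\<close> points adds the residues modulo \<open>n\<close> and an infinite point, and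
  matches the new points by the reflections \<open>j \<mapsto> 2 * i - j\<close>, one for every old point \<open>i\<close>. A
  nontrivial subsystem that meets the new points traces a coset of \<open>\<int>/n\<close> on the old ones; hence it
  is everything unless some proper coset is closed under the old blocks. Labelling the doubled
  system by \<open>0, \<dots>, 2 * n\<close> in the obvious way, no proper coset modulo \<open>2 * n + 1\<close> is closed, so a
  second doubling already has no nontrivial subsystems besides itself and those of the system it
  extends.

  Every old block \<open>{x, y, z}\<close> lies in a Pasch configuration with three new points, and switching it
  destroys the block without creating subsystems. So, starting from any finite system that contains
  the given partial one and doubling once for every unwanted block, all subsystems using unwanted
  blocks disappear. The initial embedding is built by doubling as well: one missing block at a
  time is forced by trading three blocks in its place.\<close>

section \<open>Closed sets and uniqueness of blocks in Steiner triple systems\<close>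

text \<open>Subsystems are handled through their point sets alone. As \<open>{p, q, r}\<close> is
  unordered, the condition applies to every choice of two points of a block.\<close>

definition sub_closed :: "'a set set \<Rightarrow> 'a set \<Rightarrow> bool" where
  "sub_closed B W \<longleftrightarrow> (\<forall>p q r. {p, q, r} \<in> B \<longrightarrow> p \<in> W \<longrightarrow> q \<in> W \<longrightarrow> r \<in> W)"

lemma sub_closedD: "sub_closed B W \<Longrightarrow> {p, q, r} \<in> B \<Longrightarrow> p \<in> W \<Longrightarrow> q \<in> W \<Longrightarrow> r \<in> W"
  unfolding sub_closed_def by blast

lemma card_3_distinct: "card {p, q, r} = 3 \<longleftrightarrow> p \<noteq> q \<and> p \<noteq> r \<and> q \<noteq> r"
  by (auto simp: card_insert_if)

lemma card_3_third:
  assumes "card b = 3" "p \<in> b" "q \<in> b" "p \<noteq> q"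
  obtains r where "b = {p, q, r}" "r \<noteq> p" "r \<noteq> q"
proof -
  obtain u v w where "b = {u, v, w}" "u \<noteq> v" "u \<noteq> w" "v \<noteq> w"
    using assms(1) by (auto simp: card_3_iff)
  then show thesis using assms that[of u] that[of v] that[of w] by auto
qed

lemma sts_block:
  assumes "sts V B" "b \<in> B"
  shows "b \<subseteq> V" "card b = 3"
  using assms unfolding sts_def partial_sts_def by auto

lemma sts_distinct:
  assumes "sts V B" "{p, q, r} \<in> B"
  shows "p \<noteq> q" "p \<noteq> r" "q \<noteq> r" "p \<in> V" "q \<in> V" "r \<in> V"
  using sts_block[OF assms] by (auto simp: card_3_distinct)

lemma sts_ex_third:
  assumes "sts V B" "p \<in> V" "q \<in> V" "p \<noteq> q"
  obtains r where "{p, q, r} \<in> B"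
proof -
  have "\<exists>!b. b \<in> B \<and> {p, q} \<subseteq> b" using assms unfolding sts_def by simp
  then obtain b where b: "b \<in> B" "{p, q} \<subseteq> b" by (metis (no_types, lifting))
  then obtain r where "b = {p, q, r}"
    using card_3_third[of b p q] sts_block[OF assms(1) b(1)] assms(4) by auto
  with b show thesis using that by auto
qed

lemma sts_unique_block:
  assumes "sts V B" "b \<in> B" "b' \<in> B" "{p, q} \<subseteq> b" "{p, q} \<subseteq> b'" "p \<noteq> q"
  shows "b = b'"
proof -
  have "p \<in> V" "q \<in> V" using sts_block(1)[OF assms(1,2)] assms(4) by auto
  then have "\<exists>!b. b \<in> B \<and> {p, q} \<subseteq> b" using assms(1,6) unfolding sts_def by blast
  then show ?thesis using assms(2-5) by (metis (no_types, lifting))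
qed

lemma sts_unique_third:
  assumes "sts V B" "{p, q, r} \<in> B" "{p, q, s} \<in> B"
  shows "r = s"
proof -
  have "{p, q, r} = {p, q, s}"
    using sts_unique_block[OF assms, of p q] sts_distinct(1)[OF assms(1,2)] by simp
  then have "r \<in> {p, q, s}" by blast
  then show ?thesis using sts_distinct[OF assms(1,2)] by blast
qed

lemma stsI:
  assumes "\<And>b. b \<in> B \<Longrightarrow> b \<subseteq> V \<and> card b = 3"
    and "\<And>x y. x \<in> V \<Longrightarrow> y \<in> V \<Longrightarrow> x \<noteq> y \<Longrightarrow> \<exists>!b. b \<in> B \<and> {x, y} \<subseteq> b"
  shows "sts V B"
proof -
  have "\<exists>\<^sub>\<le>\<^sub>1 b. b \<in> B \<and> {x, y} \<subseteq> b" if "x \<in> V" "y \<in> V" "x \<noteq> y" for x y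
    using assms(2)[OF that] unfolding Uniq_def by (metis (no_types, lifting))
  with assms show ?thesis unfolding sts_def partial_sts_def by (intro conjI ballI impI) simp_all
qed

section \<open>Counting blocks, trading them and relabelling points\<close>

definition offdiag :: "'a set \<Rightarrow> ('a \<times> 'a) set" where
  "offdiag V = {(x, y). x \<in> V \<and> y \<in> V \<and> x \<noteq> y}"

lemma finite_offdiag: "finite V \<Longrightarrow> finite (offdiag V)"
  by (rule finite_subset[of _ "V \<times> V"]) (auto simp: offdiag_def)

lemma card_offdiag:
  assumes "finite V"
  shows "card (offdiag V) = card V * (card V - 1)"
proof -
  have "offdiag V = (SIGMA x:V. V - {x})" by (auto simp: offdiag_def)
  then show ?thesis using assms by (simp add: card_SigmaI)
qed

text \<open>Double counting: a block of three points contains six ordered pairs of distinct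
  points.\<close>

lemma sum_pair_degree:
  assumes "finite V" "finite B" "\<And>b. b \<in> B \<Longrightarrow> b \<subseteq> V \<and> card b = 3"
  shows "(\<Sum>p\<in>offdiag V. card {b \<in> B. {fst p, snd p} \<subseteq> b}) = 6 * card B"
proof -
  have card_filter: "card {x \<in> X. Q x} = (\<Sum>x\<in>X. if Q x then 1 else 0)"
    if "finite X" for X :: "'c set" and Q
    using that by (simp add: sum.inter_filter[symmetric])
  have "(\<Sum>p\<in>offdiag V. card {b \<in> B. {fst p, snd p} \<subseteq> b})
      = (\<Sum>p\<in>offdiag V. \<Sum>b\<in>B. if {fst p, snd p} \<subseteq> b then 1 else 0)"
    by (intro sum.cong refl card_filter assms(2))
  also have "\<dots> = (\<Sum>b\<in>B. \<Sum>p\<in>offdiag V. if {fst p, snd p} \<subseteq> b then 1 else 0)"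
    by (rule sum.swap)
  also have "\<dots> = (\<Sum>b\<in>B. card {p \<in> offdiag V. {fst p, snd p} \<subseteq> b})"
    by (intro sum.cong refl card_filter[symmetric] finite_offdiag assms(1))
  also have "\<dots> = (\<Sum>b\<in>B. 6)"
  proof (rule sum.cong[OF refl])
    fix b assume b: "b \<in> B"
    have "{p \<in> offdiag V. {fst p, snd p} \<subseteq> b} = offdiag b"
      using assms(3)[OF b] by (auto simp: offdiag_def)
    moreover have "finite b" using assms(3)[OF b] by (auto intro: card_ge_0_finite)
    ultimately show "card {p \<in> offdiag V. {fst p, snd p} \<subseteq> b} = 6"
      using card_offdiag[of b] assms(3)[OF b] by simp
  qed
  finally show ?thesis by simp
qed

text \<open>Every pair degree is at least one, and by double counting the degrees sum to at most the
  number of pairs, so all equal one. Later constructions check coverage and a block count in place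
  of uniqueness.\<close>

lemma sts_countI:
  assumes fin: "finite V" "finite B"
    and blk: "\<And>b. b \<in> B \<Longrightarrow> b \<subseteq> V \<and> card b = 3"
    and cov: "\<And>x y. x \<in> V \<Longrightarrow> y \<in> V \<Longrightarrow> x \<noteq> y \<Longrightarrow> \<exists>b\<in>B. {x, y} \<subseteq> b"
    and cnt: "6 * card B \<le> card V * (card V - 1)"
  shows "sts V B"
proof (rule stsI)
  define deg where "deg p = card {b \<in> B. {fst p, snd p} \<subseteq> b}" for p :: "'a \<times> 'a"
  have ge: "1 \<le> deg p" if "p \<in> offdiag V" for p
  proof -
    have "{b \<in> B. {fst p, snd p} \<subseteq> b} \<noteq> {}"
      using cov[of "fst p" "snd p"] that by (auto simp: offdiag_def)
    then show ?thesis unfolding deg_def using fin by (simp add: Suc_leI card_gt_0_iff)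
  qed
  have "sum deg (offdiag V) \<le> (\<Sum>p\<in>offdiag V. 1)"
    using sum_pair_degree[OF fin blk] cnt card_offdiag[OF fin(1)] by (simp add: deg_def)
  then have one: "deg p = 1" if "p \<in> offdiag V" for p
    using sum_mono_inv[of "\<lambda>_. 1" "offdiag V" deg p] ge that finite_offdiag[OF fin(1)]
      sum_mono[of "offdiag V" "\<lambda>_. 1" deg] by (metis le_antisym)
  fix x y assume "x \<in> V" "y \<in> V" "x \<noteq> y"
  then have "card {b \<in> B. {x, y} \<subseteq> b} = 1"
    using one[of "(x, y)"] by (simp add: deg_def offdiag_def)
  then obtain b where b: "{b \<in> B. {x, y} \<subseteq> b} = {b}" by (rule card_1_singletonE)
  show "\<exists>!b. b \<in> B \<and> {x, y} \<subseteq> b"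
  proof (rule ex1I[of _ b])
    show "b \<in> B \<and> {x, y} \<subseteq> b" using b by (metis (mono_tags) insertI1 mem_Collect_eq)
    show "c = b" if "c \<in> B \<and> {x, y} \<subseteq> c" for c
      using b that by (metis (mono_tags) singletonD mem_Collect_eq)
  qed
qed (rule blk)

lemma finite_sts: "sts V B \<Longrightarrow> finite V \<Longrightarrow> finite B"
  by (rule finite_subset[of _ "Pow V"]) (auto dest: sts_block)

lemma card_sts:
  assumes "sts V B" "finite V"
  shows "6 * card B = card V * (card V - 1)"
proof -
  have "card {b \<in> B. {fst p, snd p} \<subseteq> b} = 1" if p: "p \<in> offdiag V" for p
  proof -
    have "fst p \<in> V" "snd p \<in> V" "fst p \<noteq> snd p" using p by (auto simp: offdiag_def)
    then have "\<exists>!b. b \<in> B \<and> {fst p, snd p} \<subseteq> b"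
      using assms(1) unfolding sts_def by blast
    then obtain b where b: "b \<in> B" "{fst p, snd p} \<subseteq> b"
      and unique: "\<And>c. c \<in> B \<and> {fst p, snd p} \<subseteq> c \<Longrightarrow> c = b"
      by (metis (no_types, lifting))
    have "{b \<in> B. {fst p, snd p} \<subseteq> b} = {b}"
    proof (intro subset_antisym subsetI)
      show "c \<in> {b}" if "c \<in> {b \<in> B. {fst p, snd p} \<subseteq> b}" for c
        using unique[of c] that by (simp del: insert_subset)
    qed (use b in \<open>simp del: insert_subset\<close>)
    then show ?thesis by (metis is_singletonI is_singleton_altdef)
  qed
  then have "(\<Sum>p\<in>offdiag V. card {b \<in> B. {fst p, snd p} \<subseteq> b}) = (\<Sum>p\<in>offdiag V. 1)"
    by (intro sum.cong refl)
  moreover have "\<And>b. b \<in> B \<Longrightarrow> b \<subseteq> V \<and> card b = 3" using sts_block[OF assms(1)] by blast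
  ultimately show ?thesis
    using sum_pair_degree[OF assms(2) finite_sts[OF assms]] card_offdiag[OF assms(2)]
    by (metis card_eq_sum)
qed

text \<open>The pairs lost with \<open>R\<close> are recovered by \<open>T\<close> and the number of
  blocks does not grow, so the counting criterion applies.\<close>

lemma sts_trade:
  assumes sts: "sts V B" "finite V" and R: "R \<subseteq> B" and T: "finite T"
    and blk: "\<And>b. b \<in> T \<Longrightarrow> b \<subseteq> V \<and> card b = 3"
    and cov: "\<And>b x y. b \<in> R \<Longrightarrow> x \<in> b \<Longrightarrow> y \<in> b \<Longrightarrow> x \<noteq> y \<Longrightarrow> \<exists>c\<in>T. {x, y} \<subseteq> c"
    and cnt: "card T \<le> card R"
  shows "sts V (B - R \<union> T)"
proof (rule sts_countI)
  have fB: "finite B" by (rule finite_sts[OF sts])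
  then show "finite (B - R \<union> T)" using T by simp
  have "card (B - R \<union> T) \<le> card (B - R) + card T" by (rule card_Un_le)
  also have "\<dots> \<le> card B" using cnt card_Diff_subset[OF finite_subset[OF R fB] R] card_mono[OF fB R] by linarith
  finally show "6 * card (B - R \<union> T) \<le> card V * (card V - 1)"
    using card_sts[OF sts] by simp
  fix x y assume xy: "x \<in> V" "y \<in> V" "x \<noteq> y"
  obtain z where "{x, y, z} \<in> B" by (rule sts_ex_third[OF sts(1) xy])
  then show "\<exists>b\<in>B - R \<union> T. {x, y} \<subseteq> b"
    using cov[of "{x, y, z}" x y] xy(3) by (cases "{x, y, z} \<in> R") auto
next
  show "b \<subseteq> V \<and> card b = 3" if "b \<in> B - R \<union> T" for b
    using that blk sts_block[OF sts(1), of b] by blast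
qed (rule sts(2))

lemma sts_image:
  assumes "sts V B" "inj_on f V"
  shows "sts (f ` V) ((`) f ` B)"
proof (rule stsI)
  fix b assume "b \<in> (`) f ` B"
  then obtain b0 where b0: "b0 \<in> B" "b = f ` b0" by auto
  have "inj_on f b0" using assms(2) sts_block(1)[OF assms(1) b0(1)] by (rule inj_on_subset)
  then show "b \<subseteq> f ` V \<and> card b = 3"
    using b0 sts_block[OF assms(1) b0(1)] by (auto simp: card_image)
next
  fix x y assume "x \<in> f ` V" "y \<in> f ` V" "x \<noteq> y"
  then obtain u v where uv: "u \<in> V" "v \<in> V" "x = f u" "y = f v" "u \<noteq> v" by auto
  have mem: "f w \<in> f ` b \<longleftrightarrow> w \<in> b" if "b \<in> B" "w \<in> V" for b w
    using inj_on_image_mem_iff[OF assms(2) that(2) sts_block(1)[OF assms(1) that(1)]] .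
  obtain w where "{u, v, w} \<in> B" using sts_ex_third[OF assms(1) uv(1,2,5)] .
  then obtain b where b: "b \<in> B" "{u, v} \<subseteq> b" by blast
  show "\<exists>!b. b \<in> (`) f ` B \<and> {x, y} \<subseteq> b"
  proof (rule ex1I[of _ "f ` b"])
    show "f ` b \<in> (`) f ` B \<and> {x, y} \<subseteq> f ` b" using b uv by auto
    fix c assume "c \<in> (`) f ` B \<and> {x, y} \<subseteq> c"
    then obtain c0 where c0: "c0 \<in> B" "c = f ` c0" "f u \<in> f ` c0" "f v \<in> f ` c0" using uv by auto
    then have "{u, v} \<subseteq> c0" using mem[OF c0(1)] uv(1,2) by simp
    then show "c = f ` b" using sts_unique_block[OF assms(1) c0(1) b(1) _ b(2) uv(5)] c0 by simp
  qed
qed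

text \<open>The block of the subsystem through \<open>p\<close> and \<open>q\<close> is also a block
  of \<open>B\<close>, so by uniqueness its third point is \<open>r\<close>.\<close>

lemma subsystem_closed:
  assumes "subsystem W C V B" "sts V B"
  shows "sub_closed B W"
  unfolding sub_closed_def
proof (intro allI impI)
  fix p q r assume b: "{p, q, r} \<in> B" and W: "p \<in> W" "q \<in> W"
  have C: "sts W C" "C \<subseteq> B" using assms(1) unfolding subsystem_def embedded_def by auto
  obtain s where s: "{p, q, s} \<in> C"
    using sts_ex_third[OF C(1) W sts_distinct(1)[OF assms(2) b]] .
  then have "r = s" using sts_unique_third[OF assms(2) b] C(2) by blast
  then show "r \<in> W" using sts_distinct[OF C(1) s] by simp
qed

text \<open>Pairing \<open>q\<close> with the third point of the block through \<open>p\<close> and \<open>q\<close>.\<close>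

lemma card_eq_of_third:
  assumes sts: "sts V B" and PQ: "P \<subseteq> V" "Q \<subseteq> V" and p: "p \<in> V" "p \<notin> P" "p \<notin> Q"
    and 1: "\<And>q r. q \<in> P \<Longrightarrow> {p, q, r} \<in> B \<Longrightarrow> r \<in> Q"
    and 2: "\<And>q r. q \<in> Q \<Longrightarrow> {p, q, r} \<in> B \<Longrightarrow> r \<in> P"
  shows "card P = card Q"
proof -
  define g where "g q = (SOME r. {p, q, r} \<in> B)" for q
  have g: "{p, q, g q} \<in> B" if "q \<in> V" "q \<noteq> p" for q
    unfolding g_def by (rule sts_ex_third[OF sts p(1) that(1)]) (use that in \<open>auto intro: someI\<close>)
  \<comment> \<open>Passing to the third point of the block with \<open>p\<close> is an involution,
    so \<open>g\<close> is its own inverse between \<open>P\<close> and \<open>Q\<close>.\<close>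
  have gg: "g (g q) = q" if "q \<in> V" "q \<noteq> p" for q
  proof -
    note b = g[OF that]
    have "{p, g q, g (g q)} \<in> B" using sts_distinct[OF sts b] by (intro g) auto
    moreover have "{p, g q, q} \<in> B" using b by (simp add: insert_commute)
    ultimately show ?thesis by (rule sts_unique_third[OF sts])
  qed
  have "bij_betw g P Q"
  proof (rule bij_betw_byWitness[of _ g])
    have "q \<in> V" "q \<noteq> p" if "q \<in> P \<union> Q" for q using that PQ p by auto
    then show "\<forall>q\<in>P. g (g q) = q" "\<forall>q\<in>Q. g (g q) = q" "g ` P \<subseteq> Q" "g ` Q \<subseteq> P"
      using g gg 1 2 by blast+
  qed
  then show ?thesis by (rule bij_betw_same_card)
qed

section \<open>Residues modulo an odd number, and the doubling construction\<close>

lemma ex_residue: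
  assumes "n > 0"
  obtains l where "l < n" "int n dvd e - int l"
proof
  show "nat (e mod int n) < n" using assms by (simp add: nat_less_iff)
  show "int n dvd e - int (nat (e mod int n))" using assms by (simp add: minus_mod_eq_mult_div)
qed

lemma residue_unique:
  assumes "int n dvd int k - int l" "k < n" "l < n"
  shows "k = l"
proof -
  have "\<bar>int k - int l\<bar> < int n" using assms(2,3) by linarith
  then show ?thesis using zdvd_not_zless dvd_imp_le_int[of "int k - int l" "int n"] assms(1) by force
qed

lemma odd_dvd_double:
  assumes "odd n" "int n dvd 2 * e"
  shows "int n dvd e"
proof -
  have "coprime (int n) 2" using assms(1) by simp
  then show ?thesis using assms(2) by (simp add: coprime_dvd_mult_right_iff)
qed

lemma ex_half_residue:
  assumes "odd n"
  obtains l where "l < n" "int n dvd e - 2 * int l"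
proof -
  obtain q where q: "n = 2 * q + 1" using assms by (auto elim: oddE)
  \<comment> \<open>For \<open>n = 2 * q + 1\<close> the number \<open>q + 1\<close> is an inverse
    of 2 modulo \<open>n\<close>.\<close>
  obtain l where l: "l < n" "int n dvd e * (int q + 1) - int l"
    using ex_residue[of n] q by auto
  have "int n dvd 2 * (e * (int q + 1) - int l) - e * int n"
    by (rule dvd_diff[OF dvd_mult[OF l(2)] dvd_triv_right])
  moreover have "2 * (e * (int q + 1) - int l) - e * int n = e - 2 * int l"
    by (simp add: q algebra_simps)
  ultimately have "int n dvd e - 2 * int l" by (simp only:)
  then show thesis using that l(1) by blast
qed

lemma half_residue_unique:
  assumes "odd n" "int n dvd e - 2 * int k" "int n dvd e - 2 * int l" "k < n" "l < n"
  shows "k = l"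
proof -
  have "int n dvd (e - 2 * int l) - (e - 2 * int k)" using assms(2,3) by (rule dvd_diff[rotated])
  then have "int n dvd 2 * (int k - int l)" by (simp add: algebra_simps)
  then show ?thesis using residue_unique[OF odd_dvd_double[OF assms(1)]] assms(4,5) by simp
qed

text \<open>The new points \<open>n + j\<close> stand for the residues modulo \<open>n\<close> and \<open>2 * n\<close> for an infinite
  point; the old point \<open>i\<close> is attached to the one-factor of the reflection \<open>j \<mapsto> 2 * i - j\<close>.\<close>

definition doubling :: "nat \<Rightarrow> nat set set \<Rightarrow> nat set set" where
  "doubling n B = B \<union>
     {{i, n + j, n + k} | i j k.
        i < n \<and> j < n \<and> k < n \<and> j \<noteq> k \<and> int n dvd int j + int k - 2 * int i} \<union>
     {{i, n + i, 2 * n} | i. i < n}"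

lemma doubling_oldI: "b \<in> B \<Longrightarrow> b \<in> doubling n B"
  unfolding doubling_def by blast

lemma doubling_reflectionI:
  "i < n \<Longrightarrow> j < n \<Longrightarrow> k < n \<Longrightarrow> j \<noteq> k \<Longrightarrow> int n dvd int j + int k - 2 * int i \<Longrightarrow>
    {i, n + j, n + k} \<in> doubling n B"
  unfolding doubling_def by blast

lemma doubling_infinityI: "i < n \<Longrightarrow> {i, n + i, 2 * n} \<in> doubling n B"
  unfolding doubling_def by blast

lemma doubling_cases:
  assumes "b \<in> doubling n B"
  obtains (old) "b \<in> B"
  | (reflection) i j k where "b = {i, n + j, n + k}" "i < n" "j < n" "k < n" "j \<noteq> k"
      "int n dvd int j + int k - 2 * int i"
  | (infinity) i where "b = {i, n + i, 2 * n}" "i < n"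
  using assms unfolding doubling_def by blast

lemma doubling_mixed:
  assumes "b \<in> doubling n B" "b \<notin> B"
  obtains i p q where "b = {i, p, q}" "i < n" "n \<le> p" "n \<le> q" "p \<noteq> q"
  using assms
proof (cases rule: doubling_cases)
  case (reflection i j k)
  then show thesis using that[of i "n + j" "n + k"] by simp
next
  case (infinity i)
  then show thesis using that[of i "n + i" "2 * n"] by simp
qed simp

lemma card_less_pairs: "2 * card {(j, k). j < k \<and> k < (n::nat)} = n * (n - 1)"
proof -
  have "{(j, k). j < k \<and> k < n} = (\<lambda>(k, j). (j, k)) ` (SIGMA k:{..<n}. {..<k})" by auto
  then have "card {(j, k). j < k \<and> k < n} = card (SIGMA k:{..<n}. {..<k})"
    by (simp add: card_image inj_on_def)
  also have "\<dots> = (\<Sum>k<n. k)" by (simp add: card_SigmaI)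
  also have "2 * \<dots> = n * (n - 1)" by (induction n) (auto simp: algebra_simps)
  finally show ?thesis by simp
qed

text \<open>The three kinds of blocks number \<open>n * (n - 1) / 6\<close>, at most
  \<open>n * (n - 1) / 2\<close> and at most \<open>n\<close>. These add up to the block count of a
  system on \<open>2 * n + 1\<close> points, so coverage of all pairs suffices.\<close>

lemma sts_doubling:
  assumes sts: "sts {..<n} B" and odd: "odd n"
  shows "sts {..<2 * n + 1} (doubling n B)"
proof (rule sts_countI)
  define R where "R = {{i, n + j, n + k} | i j k.
        i < n \<and> j < n \<and> k < n \<and> j \<noteq> k \<and> int n dvd int j + int k - 2 * int i}"
  define I where "I = {{i, n + i, 2 * n} | i. i < n}"
  have D: "doubling n B = B \<union> R \<union> I" unfolding doubling_def R_def I_def by simp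
  \<comment> \<open>Midpoints modulo an odd number are unique, so a block in \<open>R\<close> is
    determined by its two new points.\<close>
  define mid where "mid j k = (SOME i. i < n \<and> int n dvd int j + int k - 2 * int i)" for j k
  have "b \<in> (\<lambda>(j, k). {mid j k, n + j, n + k}) ` {(j, k). j < k \<and> k < n}" if bR: "b \<in> R" for b
  proof -
    obtain i j k where b: "b = {i, n + j, n + k}" "i < n" "j < n" "k < n" "j \<noteq> k"
      "int n dvd int j + int k - 2 * int i"
      using bR unfolding R_def by blast
    then have "\<exists>l. l < n \<and> int n dvd int j + int k - 2 * int l" by blast
    from someI_ex[OF this] have "mid j k < n" "int n dvd int j + int k - 2 * int (mid j k)"
      unfolding mid_def by blast+
    then have "mid j k = i" using half_residue_unique[OF odd] b by blast
    moreover have "mid k j = mid j k" unfolding mid_def by (simp add: add.commute)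
    ultimately have eq: "b = (\<lambda>(j, k). {mid j k, n + j, n + k}) (j, k)"
      "b = (\<lambda>(j, k). {mid j k, n + j, n + k}) (k, j)"
      using b(1) by (simp_all add: insert_commute)
    show ?thesis
    proof (cases "j < k")
      case True
      then show ?thesis using b(4) eq(1) by (intro image_eqI[where x = "(j, k)"]) simp_all
    next
      case False
      then show ?thesis using b(3,5) eq(2) by (intro image_eqI[where x = "(k, j)"]) simp_all
    qed
  qed
  then have Rsub: "R \<subseteq> (\<lambda>(j, k). {mid j k, n + j, n + k}) ` {(j, k). j < k \<and> k < n}" by blast
  have fp: "finite {(j, k). j < k \<and> k < n}"
    by (rule finite_subset[of _ "{..<n} \<times> {..<n}"]) auto
  have R: "finite R" "2 * card R \<le> n * (n - 1)"
    using Rsub fp card_less_pairs[of n] surj_card_le[OF fp Rsub] by (auto intro: finite_surj)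
  have "I = (\<lambda>i. {i, n + i, 2 * n}) ` {..<n}" unfolding I_def by auto
  then have I: "finite I" "card I \<le> n" using card_image_le[of "{..<n}"] by auto
  have B: "finite B" "6 * card B = n * (n - 1)"
    using finite_sts[OF sts] card_sts[OF sts] by auto
  show "finite (doubling n B)" using D B R I by simp
  have "card (doubling n B) \<le> card B + card R + card I"
    unfolding D using card_Un_le[of "B \<union> R" I] card_Un_le[of B R] by linarith
  then have "6 * card (doubling n B) \<le> n * (n - 1) + 3 * (n * (n - 1)) + 6 * n"
    using B R I by linarith
  also have "\<dots> = (2 * n + 1) * (2 * n)" using odd by (cases n) (auto simp: algebra_simps)
  finally show "6 * card (doubling n B) \<le> card {..<2 * n + 1} * (card {..<2 * n + 1} - 1)" by simp
  show "b \<subseteq> {..<2 * n + 1} \<and> card b = 3" if "b \<in> doubling n B" for b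
    using that
  proof (cases rule: doubling_cases)
    case old
    show ?thesis using sts_block(1)[OF sts old] sts_block(2)[OF sts old] by force
  next
    case (reflection i j k)
    then show ?thesis by (simp add: card_3_distinct)
  next
    case (infinity i)
    then show ?thesis by (simp add: card_3_distinct)
  qed
  have n0: "n > 0" using odd by (cases n) auto
  have cov: "\<exists>b\<in>doubling n B. {x, y} \<subseteq> b" if lt: "x < y" "y < 2 * n + 1" for x y
  proof -
    consider "y < n" | "x < n" "n \<le> y" "y < 2 * n" | "n \<le> x" "y < 2 * n" | "y = 2 * n" "x < n"
      | "y = 2 * n" "n \<le> x" "x < 2 * n" using lt by linarith
    then show ?thesis
    proof cases
      case 1
      then obtain z where "{x, y, z} \<in> B" using sts_ex_third[OF sts, of x y] lt by auto
      then show ?thesis by (intro bexI[OF _ doubling_oldI[of "{x, y, z}" B]]) simp_all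
    next
      case 2
      then obtain j where j: "y = n + j" "j < n" using le_Suc_ex[of n y] by auto
      obtain k where k: "k < n" "int n dvd (2 * int x - int j) - int k"
        using ex_residue[OF n0] .
      have d: "int n dvd int j + int k - 2 * int x"
        using k(2) by (subst dvd_minus_iff[symmetric]) (simp add: algebra_simps)
      \<comment> \<open>The only fixed point of the reflection at \<open>x\<close> is
        \<open>x\<close> itself; the block through the infinite point takes care of it.\<close>
      show ?thesis
      proof (cases "j = k")
        case True
        then have "int n dvd 2 * (int j - int x)" using d by (simp add: algebra_simps)
        then have "j = x" using residue_unique[OF odd_dvd_double[OF odd]] j 2 by simp
        with j 2 show ?thesis by (intro bexI[OF _ doubling_infinityI[of x n B]]) simp_all
      next
        case False
        show ?thesis using j(1)
          by (intro bexI[OF _ doubling_reflectionI[OF 2(1) j(2) k(1) False d, of B]]) simp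
      qed
    next
      case 3
      then obtain j where j: "x = n + j" "j < n" using le_Suc_ex[of n x] lt by auto
      obtain k where k: "y = n + k" "k < n" using le_Suc_ex[of n y] lt 3 by auto
      obtain i where i: "i < n" "int n dvd int j + int k - 2 * int i"
        using ex_half_residue[OF odd] .
      have "j \<noteq> k" using j(1) k(1) lt(1) by simp
      then show ?thesis using j(1) k(1)
        by (intro bexI[OF _ doubling_reflectionI[OF i(1) j(2) k(2) _ i(2), of B]]) simp_all
    next
      case 4
      then show ?thesis by (intro bexI[OF _ doubling_infinityI[of x n B]]) simp_all
    next
      case 5
      then obtain j where "x = n + j" "j < n" using le_Suc_ex[of n x] by auto
      with 5(1) show ?thesis by (intro bexI[OF _ doubling_infinityI[of j n B]]) simp_all
    qed
  qed
  show "\<exists>b\<in>doubling n B. {x, y} \<subseteq> b"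
    if "x \<in> {..<2 * n + 1}" "y \<in> {..<2 * n + 1}" "x \<noteq> y" for x y
  proof (cases "x < y")
    case True
    then show ?thesis using cov[of x y] that by simp
  next
    case False
    then show ?thesis using cov[of y x] that by (simp add: insert_commute)
  qed
qed simp

section \<open>Ternary closed sets as cosets\<close>

text \<open>The nonempty subsets of \<open>{..<n}\<close> with this property are the cosets of
  subgroups of the integers modulo \<open>n\<close>.\<close>

definition ternary_closed :: "nat \<Rightarrow> nat set \<Rightarrow> bool" where
  "ternary_closed n S \<longleftrightarrow> (\<forall>i\<in>S. \<forall>j\<in>S. \<forall>k\<in>S. \<forall>l<n.
     int n dvd int i + int j - int k - int l \<longrightarrow> l \<in> S)"

text \<open>The integers congruent to differences of elements of \<open>S\<close> form a subgroup
  containing \<open>n\<close>; its least positive element is \<open>d\<close>.\<close>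

lemma ternary_closed_coset:
  assumes n: "n > 0" and S: "S \<subseteq> {..<n}" "S \<noteq> {}" and tern: "ternary_closed n S"
  obtains d r where "d > 0" "d dvd n" "r < d" "S = {x. x < n \<and> x mod d = r}"
proof -
  define G where "G = {e. \<exists>s\<in>S. \<exists>l\<in>S. int n dvd int s + e - int l}"
  obtain s0 where s0: "s0 \<in> S" using S by blast
  have G_diff: "e - e' \<in> G" if e: "e \<in> G" "e' \<in> G" for e e'
  proof -
    obtain s l s' l' where sl: "s \<in> S" "l \<in> S" "s' \<in> S" "l' \<in> S"
      and d: "int n dvd int s + e - int l" "int n dvd int s' + e' - int l'"
      using e unfolding G_def by blast
    \<comment> \<open>The residue \<open>m\<close> of \<open>l + s' - l'\<close> lies in
      \<open>S\<close>, and \<open>m - s\<close> realises \<open>e - e'\<close>.\<close>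
    obtain m where m: "m < n" "int n dvd (int l + int s' - int l') - int m" using ex_residue[OF n] .
    have "m \<in> S" using tern sl m unfolding ternary_closed_def by blast
    moreover have "int s + (e - e') - int m
        = (int s + e - int l) - (int s' + e' - int l') + (int l + int s' - int l' - int m)"
      by simp
    then have "int n dvd int s + (e - e') - int m"
      using d m(2) by (metis dvd_add dvd_diff)
    ultimately show ?thesis using sl(1) unfolding G_def by blast
  qed
  have G_n: "int n \<in> G" unfolding G_def using s0 by (intro CollectI bexI[of _ s0]) auto
  define d where "d = (LEAST d. d > 0 \<and> int d \<in> G)"
  have d: "d > 0" "int d \<in> G"
    unfolding d_def using LeastI[of "\<lambda>d. d > 0 \<and> int d \<in> G" n] n G_n by auto
  have G_0: "0 \<in> G" using G_diff[OF G_n G_n] by simp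
  have G_add: "e + e' \<in> G" if "e \<in> G" "e' \<in> G" for e e'
    using G_diff[OF that(1) G_diff[OF G_0 that(2)]] by simp
  have G_nat: "int (m * d) \<in> G" for m
    by (induction m) (use G_0 G_add d(2) in \<open>auto simp: algebra_simps\<close>)
  have G_mult: "int d * z \<in> G" for z
    using G_nat[of "nat z"] G_diff[OF G_0 G_nat[of "nat (- z)"]]
    by (cases "z \<ge> 0") (auto simp: mult.commute)
  have G_dvd: "e \<in> G \<longleftrightarrow> int d dvd e" for e
  proof
    assume e: "e \<in> G"
    \<comment> \<open>Division with remainder: the remainder lies in \<open>G\<close> and below
      \<open>d\<close>, so minimality makes it zero.\<close>
    have "e mod int d \<in> G" using G_diff[OF e G_mult[of "e div int d"]]
      by (simp add: minus_mult_div_eq_mod)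
    moreover have "0 \<le> e mod int d" "e mod int d < int d" using d(1) by auto
    ultimately have "nat (e mod int d) = 0"
      using not_less_Least[of "nat (e mod int d)" "\<lambda>d. d > 0 \<and> int d \<in> G"]
      unfolding d_def[symmetric] by (simp add: nat_less_iff)
    then show "int d dvd e" using \<open>0 \<le> e mod int d\<close> by (simp add: dvd_eq_mod_eq_0)
  qed (use G_mult in auto)
  have mem: "l \<in> S \<longleftrightarrow> l < n \<and> int d dvd int l - int s0" for l
  proof
    assume l: "l \<in> S"
    then have "int l - int s0 \<in> G" unfolding G_def using s0 by force
    then show "l < n \<and> int d dvd int l - int s0" using l S(1) G_dvd by blast
  next
    assume l: "l < n \<and> int d dvd int l - int s0"
    then obtain s m where sm: "s \<in> S" "m \<in> S" "int n dvd int s + (int l - int s0) - int m"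
      using G_dvd unfolding G_def by blast
    have "int n dvd int m + int s0 - int s - int l"
      using sm(3) by (subst dvd_minus_iff[symmetric]) (simp add: algebra_simps)
    then show "l \<in> S" using tern sm s0 l unfolding ternary_closed_def by blast
  qed
  show thesis
  proof (rule that[of d "s0 mod d"])
    show "d dvd n" using G_n G_dvd by simp
    have "int d dvd int l - int s0 \<longleftrightarrow> l mod d = s0 mod d" for l
      by (metis mod_eq_dvd_iff of_nat_eq_iff of_nat_mod)
    then show "S = {x. x < n \<and> x mod d = s0 mod d}" using mem by auto
  qed (use d in auto)
qed

section \<open>Closed sets of a doubling that contain new points\<close>

lemma card_le_1_if_all_eq: "finite C \<Longrightarrow> (\<And>i j. i \<in> C \<Longrightarrow> j \<in> C \<Longrightarrow> i = j) \<Longrightarrow> card C \<le> 1"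
  by (metis One_nat_def card_le_Suc0_iff_eq)

text \<open>Let \<open>S\<close> be the set of residues of the new points in \<open>W\<close>.
  Reflections at points of \<open>C\<close> preserve \<open>S\<close>, and midpoints of distinct
  elements of \<open>S\<close> lie in \<open>C\<close>. Composing reflections gives translations by
  differences of points of \<open>C\<close>, whence \<open>S = C\<close>.\<close>

lemma closed_doubling_structure:
  assumes sts: "sts {..<n} B" and odd: "odd n" and W: "W \<subseteq> {..<2 * n + 1}" "card W > 3"
    and new: "\<not> W \<subseteq> {..<n}" and closed: "sub_closed (doubling n B) W"
  defines "C \<equiv> W \<inter> {..<n}"
  shows "sub_closed B C" "ternary_closed n C" "\<exists>i\<in>C. \<exists>j\<in>C. i \<noteq> j"
    "C = {..<n} \<Longrightarrow> W = {..<2 * n + 1}"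
proof -
  let ?D = "doubling n B"
  note D = sts_doubling[OF sts odd]
  have n0: "n > 0" using odd by (cases n) auto
  have C: "i < n" "i \<in> W" if "i \<in> C" for i using that by (auto simp: C_def)
  have CI: "i \<in> C" if "i < n" "i \<in> W" for i using that by (auto simp: C_def)
  define S where "S = {k. k < n \<and> n + k \<in> W}"
  have S: "k < n" "n + k \<in> W" if "k \<in> S" for k using that by (auto simp: S_def)
  have SI: "k \<in> S" if "k < n" "n + k \<in> W" for k using that by (auto simp: S_def)
  show "sub_closed B C"
    unfolding sub_closed_def
  proof (intro allI impI)
    fix p q r assume b: "{p, q, r} \<in> B" "p \<in> C" "q \<in> C"
    then have "r \<in> W" using sub_closedD[OF closed doubling_oldI[OF b(1)]] C by blast
    then show "r \<in> C" using sts_distinct(6)[OF sts b(1)] CI by simp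
  qed
  have reflect: "l \<in> S" if "i \<in> C" "k \<in> S" "l < n" "int n dvd int k + int l - 2 * int i" for i k l
  proof (cases "l = k")
    case False
    then have "{i, n + k, n + l} \<in> ?D"
      using that C S by (intro doubling_reflectionI) auto
    from sub_closedD[OF closed this] show ?thesis using that C S SI by blast
  qed (use that in simp)
  have midpoint: "i \<in> C"
    if "j \<in> S" "k \<in> S" "j \<noteq> k" "i < n" "int n dvd int j + int k - 2 * int i" for i j k
  proof -
    have "{i, n + j, n + k} \<in> ?D" using that S by (intro doubling_reflectionI) auto
    then have "{n + j, n + k, i} \<in> ?D" by (simp add: insert_commute)
    from sub_closedD[OF closed this] show ?thesis using that S CI by blast
  qed
  have infinity: "{i, n + i, 2 * n} \<in> ?D" "{i, 2 * n, n + i} \<in> ?D" if "i < n" for i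
    using doubling_infinityI[OF that, of B] by (simp_all add: insert_commute)
  have infinityI: "2 * n \<in> W" if "i \<in> C" "i \<in> S" for i
    using sub_closedD[OF closed infinity(1)] that C S by blast
  \<comment> \<open>With at most one old point, \<open>W\<close> has three new points. The blocks
    joining \<open>p\<close> to \<open>q\<close> and to \<open>r\<close> would both pass through
    that single old point, against uniqueness.\<close>
  show two: "\<exists>i\<in>C. \<exists>j\<in>C. i \<noteq> j"
  proof (rule ccontr)
    assume "\<not> ?thesis"
    then have C_eq: "i = j" if "i \<in> C" "j \<in> C" for i j using that by blast
    have fW: "finite W" using W(1) finite_subset by blast
    have "card C \<le> 1" using C_eq fW by (intro card_le_1_if_all_eq) (auto simp: C_def)
    moreover have "card (W - C) + card C = card W"
      using fW by (metis C_def Diff_Diff_Int Diff_subset add.commute card_Diff_subset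
          card_mono finite_Diff inf_le1 le_add_diff_inverse2 finite_Int)
    ultimately have "3 \<le> card (W - C)" using W(2) by linarith
    then obtain T where "T \<subseteq> W - C" "card T = 3" by (metis obtain_subset_with_card_n)
    then obtain p q r where pqr: "p \<in> W - C" "q \<in> W - C" "r \<in> W - C" "p \<noteq> q" "p \<noteq> r" "q \<noteq> r"
      by (auto simp: card_3_iff)
    have third: "\<exists>i\<in>C. {p, u, i} \<in> ?D" if u: "u \<in> W - C" "p \<noteq> u" for u
    proof -
      have ge: "n \<le> p" "n \<le> u" using pqr u CI by (meson DiffD1 DiffD2 not_le)+
      obtain i where i: "{p, u, i} \<in> ?D"
        using sts_ex_third[OF D, of p u] pqr(1) u W(1) by blast
      have "i < n"
      proof -
        have "{p, u, i} \<notin> B" using sts_distinct(4)[OF sts, of p u i] ge by auto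
        from doubling_mixed[OF i this] show ?thesis using ge
          by (metis insertCI insertE leD singletonD)
      qed
      moreover have "i \<in> W" using sub_closedD[OF closed i] pqr u by blast
      ultimately show ?thesis using i CI by blast
    qed
    obtain i j where ij: "i \<in> C" "{p, q, i} \<in> ?D" "j \<in> C" "{p, r, j} \<in> ?D"
      using third[OF pqr(2,4)] third[OF pqr(3,5)] by blast
    then have "{p, i, q} \<in> ?D" "{p, i, r} \<in> ?D" using C_eq[of i j] by (simp_all add: insert_commute)
    then show False using sts_unique_third[OF D] pqr by blast
  qed
  \<comment> \<open>Even if the new point at hand is the infinite one, its block with an old point
    \<open>i\<close> supplies \<open>n + i\<close>.\<close>
  have S_ne: "\<exists>s. s \<in> S"
  proof -
    obtain w where w: "w \<in> W" "n \<le> w" using new by (meson lessThan_iff not_le subsetI)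
    obtain i where i: "i \<in> C" using two by blast
    show ?thesis
    proof (cases "w = 2 * n")
      case True
      then have "n + i \<in> W" using sub_closedD[OF closed infinity(2)] w C[OF i] by blast
      then show ?thesis using SI C(1)[OF i] by blast
    next
      case False
      then show ?thesis using w W(1) by (intro exI[of _ "w - n"] SI) auto
    qed
  qed
  text \<open>Two reflections make the translation by \<open>2 * (j - i)\<close>; as \<open>n\<close> is odd, a multiple of it is
    the translation by \<open>j - i\<close>.\<close>
  have shift2: "l \<in> S"
    if s: "s \<in> S" and ij: "i \<in> C" "j \<in> C" and l: "l < n" "int n dvd int s + 2 * (int j - int i) - int l"
    for s i j l
  proof -
    obtain u where u: "u < n" "int n dvd (2 * int i - int s) - int u" using ex_residue[OF n0] .
    have "int n dvd int s + int u - 2 * int i"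
      using u(2) by (subst dvd_minus_iff[symmetric]) (simp add: algebra_simps)
    then have uS: "u \<in> S" using reflect[OF ij(1) s u(1)] by blast
    have "int u + int l - 2 * int j
      = - ((int s + 2 * (int j - int i) - int l) + ((2 * int i - int s) - int u))" by simp
    then have "int n dvd int u + int l - 2 * int j"
      using u(2) l(2) by (metis dvd_add dvd_minus_iff)
    then show ?thesis using reflect[OF ij(2) uS l(1)] by blast
  qed
  have shift2m: "l \<in> S"
    if s: "s \<in> S" and ij: "i \<in> C" "j \<in> C" and l: "l < n"
      "int n dvd int s + 2 * int m * (int j - int i) - int l"
    for s i j l m
    using l
  proof (induction m arbitrary: l)
    case 0
    then have "l = s" using residue_unique[of n s l] S(1)[OF s] by simp
    then show ?case using s by simp
  next
    case (Suc m)
    obtain u where u: "u < n" "int n dvd (int s + 2 * int m * (int j - int i)) - int u"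
      using ex_residue[OF n0] .
    have uS: "u \<in> S" using Suc.IH u by blast
    have "int u + 2 * (int j - int i) - int l = (int s + 2 * int (Suc m) * (int j - int i) - int l)
       - ((int s + 2 * int m * (int j - int i)) - int u)" by (simp add: algebra_simps)
    then have "int n dvd int u + 2 * (int j - int i) - int l"
      using u(2) Suc.prems(2) by (metis dvd_diff)
    then show ?case using shift2[OF uS ij Suc.prems(1)] by blast
  qed
  have shift: "l \<in> S"
    if s: "s \<in> S" and ij: "i \<in> C" "j \<in> C" and l: "l < n" "int n dvd int s + int j - int i - int l"
    for s i j l
  proof -
    obtain q where q: "n = 2 * q + 1" using odd by (auto elim: oddE)
    have "int s + 2 * int (q + 1) * (int j - int i) - int l
      = (int s + int j - int i - int l) + (int j - int i) * int n" by (simp add: q algebra_simps)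
    then have "int n dvd int s + 2 * int (q + 1) * (int j - int i) - int l"
      using l(2) by (metis dvd_add dvd_triv_right)
    then show ?thesis using shift2m[OF s ij l(1)] by blast
  qed
  have SC: "s \<in> C" if s: "s \<in> S" for s
  proof -
    obtain i j where ij: "i \<in> C" "j \<in> C" "i \<noteq> j" using two by blast
    \<comment> \<open>Modulo \<open>n\<close>, these are \<open>s + (j - i)\<close> and
      \<open>s - (j - i)\<close>: two elements of \<open>S\<close> whose midpoint is
      \<open>s\<close>.\<close>
    obtain u where u: "u < n" "int n dvd (int s + int j - int i) - int u" using ex_residue[OF n0] .
    obtain v where v: "v < n" "int n dvd (int s + int i - int j) - int v" using ex_residue[OF n0] .
    have uv: "u \<in> S" "v \<in> S" using shift[OF s] ij u v by blast+
    have "u \<noteq> v"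
    proof
      assume "u = v"
      then have "((int s + int j - int i) - int u) - ((int s + int i - int j) - int v)
          = 2 * (int j - int i)" by simp
      then have "int n dvd 2 * (int j - int i)" using dvd_diff[OF u(2) v(2)] by simp
      then show False using residue_unique[OF odd_dvd_double[OF odd]] ij C by blast
    qed
    moreover have "int u + int v - 2 * int s
      = - (((int s + int j - int i) - int u) + ((int s + int i - int j) - int v))" by simp
    then have "int n dvd int u + int v - 2 * int s"
      using u(2) v(2) by (metis dvd_add dvd_minus_iff)
    ultimately show ?thesis using midpoint[OF uv] S(1)[OF s] by blast
  qed
  have CS: "i \<in> S" if i: "i \<in> C" for i
  proof -
    obtain s where s: "s \<in> S" using S_ne by blast
    \<comment> \<open>The translation by \<open>i - s\<close> is available because \<open>s\<close>
      lies in \<open>C\<close> by \<open>SC\<close>.\<close>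
    then show ?thesis using shift[OF s SC[OF s] i C(1)[OF i]] by simp
  qed
  show "ternary_closed n C"
    unfolding ternary_closed_def
  proof (intro ballI allI impI)
    fix i j k l assume "i \<in> C" "j \<in> C" "k \<in> C" "l < n" "int n dvd int i + int j - int k - int l"
    then show "l \<in> C" using shift[OF CS[of i], of k j l] SC by blast
  qed
  show "W = {..<2 * n + 1}" if full: "C = {..<n}"
  proof
    show "{..<2 * n + 1} \<subseteq> W"
    proof
      fix w assume "w \<in> {..<2 * n + 1}"
      then consider "w < n" | "n \<le> w" "w < 2 * n" | "w = 2 * n" by fastforce
      then show "w \<in> W"
      proof cases
        case 2
        then have "w - n \<in> S" using CS full by auto
        then show ?thesis using S(2)[of "w - n"] 2 by simp
      next
        case 3
        have "0 \<in> C" using full n0 by simp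
        then show ?thesis using infinityI CS 3 by blast
      qed (use full C in auto)
    qed
  qed (rule W(1))
qed

section \<open>Labellings without closed proper cosets\<close>

text \<open>Closed proper cosets with at least two points are the only obstruction left by
  \<open>closed_doubling_structure\<close>. The property depends on how the points are labelled by
  residues.\<close>

definition generic :: "nat \<Rightarrow> nat set set \<Rightarrow> bool" where
  "generic n B \<longleftrightarrow> (\<forall>C\<subseteq>{..<n}. sub_closed B C \<longrightarrow> ternary_closed n C \<longrightarrow>
     (\<exists>i\<in>C. \<exists>j\<in>C. i \<noteq> j) \<longrightarrow> C = {..<n})"

text \<open>The trace of \<open>W\<close> on the old points is a closed coset with two points, so
  genericity makes it everything.\<close>

lemma generic_closed_doubling:
  assumes "sts {..<n} B" "odd n" "generic n B" "W \<subseteq> {..<2 * n + 1}" "card W > 3"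
    "\<not> W \<subseteq> {..<n}" "sub_closed (doubling n B) W"
  shows "W = {..<2 * n + 1}"
proof (rule closed_doubling_structure(4)[OF assms(1,2,4-7)])
  note generic = assms(3)[unfolded generic_def, rule_format, of "W \<inter> {..<n}"]
  show "W \<inter> {..<n} = {..<n}"
    using closed_doubling_structure(1-3)[OF assms(1,2,4-7)] by (intro generic) simp_all
qed

text \<open>A proper coset \<open>{x. x mod d = r}\<close> with at least five elements would, by the structure
  of closed sets, restrict to a coset modulo a divisor of \<open>n\<close>, but \<open>n\<close> and \<open>2 * n + 1\<close> are
  coprime; the cosets with three elements are excluded by hypothesis.\<close>

lemma generic_doublingI:
  assumes sts: "sts {..<n} B" and odd: "odd n" and D: "sts {..<2 * n + 1} D"
    and reduce: "\<And>W. W \<subseteq> {..<2 * n + 1} \<Longrightarrow> card W > 3 \<Longrightarrow> \<not> W \<subseteq> {..<n} \<Longrightarrow>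
      sub_closed D W \<Longrightarrow> sub_closed (doubling n B) W"
    and line: "\<And>r m. 3 * m = 2 * n + 1 \<Longrightarrow> r < m \<Longrightarrow> {r, r + m, r + 2 * m} \<notin> D"
  shows "generic (2 * n + 1) D"
  unfolding generic_def
proof (intro allI impI)
  fix C assume C: "C \<subseteq> {..<2 * n + 1}" and closed: "sub_closed D C"
    and tern: "ternary_closed (2 * n + 1) C" and two: "\<exists>i\<in>C. \<exists>j\<in>C. i \<noteq> j"
  have "C \<noteq> {}" using two by blast
  then obtain d r where d: "d > 0" "d dvd 2 * n + 1" "r < d"
    and Cd: "C = {x. x < 2 * n + 1 \<and> x mod d = r}"
    using ternary_closed_coset[OF _ C _ tern] by auto
  \<comment> \<open>The coset has \<open>h\<close> elements, and \<open>h\<close> is odd because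
    \<open>2 * n + 1\<close> is.\<close>
  obtain h where h: "2 * n + 1 = d * h" using d(2) by blast
  have "odd h" using h 
  proof -
    have "odd (d * h)" unfolding h[symmetric] by simp
    then show ?thesis by simp
  qed
  have "h \<noteq> 1"
  proof
    assume "h = 1"
    then have "x = r" if "x \<in> C" for x using that Cd h by auto
    then show False using two by blast
  qed
  have elem: "r + k * d \<in> C" if "k < h" for k
  proof -
    have "r + k * d < Suc k * d" using d by simp
    also have "\<dots> \<le> h * d" using that by (intro mult_le_mono1) simp
    finally show ?thesis using Cd d(3) h by (simp add: mult.commute)
  qed
  show "C = {..<2 * n + 1}"
  proof (cases "d = 1")
    case True
    then show ?thesis using Cd d by auto
  next
    case d1: False
    \<comment> \<open>A closed coset of three points would be a block: the third point of the block
      through \<open>r\<close> and \<open>r + d\<close> stays inside. The hypothesis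
      \<open>line\<close> forbids this.\<close>
    have "h \<noteq> 3"
    proof
      assume h3: "h = 3"
      have e: "r \<in> C" "r + d \<in> C" "r + 2 * d \<in> C"
        using elem[of 0] elem[of 1] elem[of 2] h3 by auto
      obtain z where z: "{r, r + d, z} \<in> D" using sts_ex_third[OF D, of r "r + d"] e C d by auto
      have "z \<in> C" using sub_closedD[OF closed z] e by blast
      then have "z mod d = r" "z < 3 * d" using Cd h h3 by auto
      then have "z div d < 3" using d(1) by (simp add: less_mult_imp_div_less)
      then consider "z div d = 0" | "z div d = 1" | "z div d = 2" by linarith
      moreover have "z = z div d * d + r" using div_mult_mod_eq[of z d] \<open>z mod d = r\<close> by simp
      ultimately have "z = r \<or> z = r + d \<or> z = r + 2 * d" by cases simp_all
      then have "z = r + 2 * d" using sts_distinct(2,3)[OF D z] by simp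
      then show False using line[of d r] z d(3) h h3 by (simp add: mult.commute)
    qed
    with \<open>odd h\<close> \<open>h \<noteq> 1\<close> have h5: "h \<ge> 5" by presburger
    have "finite C" using C finite_subset by blast
    have "card {r, r + d, r + 2 * d, r + 3 * d} = 4" using d(1) by simp
    moreover have "{r, r + d, r + 2 * d, r + 3 * d} \<subseteq> C"
      using elem[of 0] elem[of 1] elem[of 2] elem[of 3] h5 by simp
    ultimately have "4 \<le> card C" using card_mono[OF \<open>finite C\<close>] by metis
    then have card: "card C > 3" by simp
    have "r + (h - 1) * d \<in> C" using elem h5 by simp
    \<comment> \<open>Since \<open>d\<close> is at most a fifth of \<open>2 * n + 1\<close>, the
      largest element of the coset is a new point.\<close>
    moreover have "n \<le> r + (h - 1) * d"
    proof -
      have "5 * d \<le> 2 * n + 1" using mult_le_mono2[OF h5, of d] h by (simp add: mult.commute)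
      moreover have "(h - 1) * d + d = 2 * n + 1"
      proof -
        have "h = Suc (h - 1)" using h5 by simp
        then have "h * d = (h - 1) * d + d" by (metis add.commute mult_Suc)
        then show ?thesis using h by (simp add: mult.commute)
      qed
      ultimately show ?thesis by linarith
    qed
    ultimately have new: "\<not> C \<subseteq> {..<n}" by auto
    define C0 where "C0 = C \<inter> {..<n}"
    note str = closed_doubling_structure[OF sts odd C card new reduce[OF C card new closed],
        folded C0_def]
    have n0: "n > 0" using odd by (cases n) auto
    obtain e s where e: "e > 0" "e dvd n" "s < e" and C0e: "C0 = {x. x < n \<and> x mod e = s}"
      using ternary_closed_coset[OF n0 _ _ str(2)] str(3) C0_def by auto
    have "e \<noteq> n"
    proof
      assume "e = n"
      then have "x = s" if "x \<in> C0" for x using that C0e by auto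
      then show False using str(3) by blast
    qed
    obtain k where k: "n = e * k" using e(2) by blast
    then have "k \<noteq> 0" "k \<noteq> 1" using \<open>e \<noteq> n\<close> n0 by auto
    then have "k \<ge> 2" by linarith
    then have "e * 2 \<le> n" using mult_le_mono2[of 2 k e] k by simp
    then have "s \<in> C0" "s + e \<in> C0" using C0e e(3) by auto
    \<comment> \<open>Both points lie in one class modulo \<open>d\<close>, so \<open>d\<close>
      divides \<open>e\<close> and hence \<open>n\<close>; as it also divides
      \<open>2 * n + 1\<close>, it is 1.\<close>
    then have "s mod d = (s + e) mod d" unfolding C0_def Cd by auto
    then have "d dvd e" by (metis add_diff_cancel_left' le_add1 mod_eq_dvd_iff_nat)
    then have "d dvd n" using e(2) dvd_trans by blast
    then have "d dvd 2 * n" by simp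
    with d(2) have "d dvd 1" using dvd_add_right_iff by blast
    with d1 show ?thesis by simp
  qed
qed

text \<open>The point \<open>r + 2 * m\<close> is new, which rules out old blocks. In a reflection
  block \<open>j + k - 2 * i\<close> would be \<open>3 * m - 2 * n = 1\<close>. In a block with the
  infinite point, comparing sums forces \<open>n = 3\<close>, and then \<open>2 * n + 1\<close> is
  no multiple of three.\<close>

lemma doubling_no_coset_line:
  assumes sts: "sts {..<n} B" and n: "n \<ge> 3" and m: "3 * m = 2 * n + 1" "r < m"
  shows "{r, r + m, r + 2 * m} \<notin> doubling n B"
proof
  have ge: "n \<le> r + 2 * m" "r < n" "0 < m" using m n by linarith+
  assume "{r, r + m, r + 2 * m} \<in> doubling n B"
  then show False
  proof (cases rule: doubling_cases)
    case old
    then show False using sts_block(1)[OF sts] ge by fastforce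
  next
    case (reflection i j k)
    have "r \<in> {i, n + j, n + k}" "r + m \<in> {i, n + j, n + k}"
      "r + 2 * m \<in> {i, n + j, n + k}"
      unfolding reflection(1)[symmetric] by simp_all
    then have "i = r" "j + k + 2 * n = 2 * r + 3 * m" using ge by auto
    then have "int j + int k - 2 * int i = 1" using m(1) by linarith
    then show False using reflection(6) n by simp
  next
    case (infinity i)
    have "r \<in> {i, n + i, 2 * n}" "r + m \<in> {i, n + i, 2 * n}"
      "r + 2 * m \<in> {i, n + i, 2 * n}"
      unfolding infinity(1)[symmetric] by simp_all
    then have "2 * r + 3 * m = 3 * n + r" using ge by auto
    then have "n = 3" using m n by linarith
    then show False using m(1) by presburger
  qed
qed

lemma generic_doubling:
  assumes "sts {..<n} B" "odd n" "n \<ge> 3"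
  shows "generic (2 * n + 1) (doubling n B)"
  using assms
  by (intro generic_doublingI sts_doubling doubling_no_coset_line)

section \<open>Pasch switches\<close>

text \<open>The removed and the added four blocks cover the same twelve pairs of the six points; the
  pairs left out by both are \<open>{x, c}\<close>, \<open>{y, b}\<close> and
  \<open>{z, a}\<close>.\<close>

definition pasch_switch :: "'a set set \<Rightarrow> 'a \<Rightarrow> 'a \<Rightarrow> 'a \<Rightarrow> 'a \<Rightarrow> 'a \<Rightarrow> 'a \<Rightarrow> 'a set set" where
  "pasch_switch B x y z a b c =
     B - {{x, y, z}, {x, a, b}, {y, a, c}, {z, b, c}} \<union>
       {{x, y, a}, {x, z, b}, {y, z, c}, {a, b, c}}"

lemma sts_pasch_switch:
  assumes sts: "sts V B" "finite V"
    and R: "{{x, y, z}, {x, a, b}, {y, a, c}, {z, b, c}} \<subseteq> B"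
    and dist: "distinct [x, y, z, a, b, c]"
  shows "sts V (pasch_switch B x y z a b c)"
  unfolding pasch_switch_def
proof (rule sts_trade[OF sts R])
  have V: "x \<in> V" "y \<in> V" "z \<in> V" "a \<in> V" "b \<in> V" "c \<in> V"
    using R sts_block(1)[OF sts(1), of "{x, y, z}"] sts_block(1)[OF sts(1), of "{x, a, b}"]
      sts_block(1)[OF sts(1), of "{y, a, c}"] by auto
  show "e \<subseteq> V \<and> card e = 3" if e: "e \<in> {{x, y, a}, {x, z, b}, {y, z, c}, {a, b, c}}" for e
    using e by (elim insertE emptyE) (use V dist in \<open>simp_all add: card_3_distinct\<close>)
  show "\<exists>f\<in>{{x, y, a}, {x, z, b}, {y, z, c}, {a, b, c}}. {p, q} \<subseteq> f"
    if e: "e \<in> {{x, y, z}, {x, a, b}, {y, a, c}, {z, b, c}}" "p \<in> e" "q \<in> e" "p \<noteq> q"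
    for e p q
    using e(1) by (elim insertE emptyE) (use e(2-4) in auto)
  have neq: "e \<noteq> f" if "u \<in> e" "u \<notin> f" for u :: 'a and e f using that by blast
  have card4: "card {e, f, g, h} = 4"
    if "e \<noteq> f" "e \<noteq> g" "e \<noteq> h" "f \<noteq> g" "f \<noteq> h" "g \<noteq> h" for e f g h :: "'a set"
    using that by simp
  have "card {{x, y, z}, {x, a, b}, {y, a, c}, {z, b, c}} = 4"
    by (rule card4[OF neq[of y] neq[of x] neq[of x] neq[of x] neq[of x] neq[of y]])
      (use dist in auto)
  moreover have "card {e, f, g, h} \<le> 4" for e f g h :: "'a set"
    by (simp add: card_insert_if)
  ultimately show "card {{x, y, a}, {x, z, b}, {y, z, c}, {a, b, c}}
      \<le> card {{x, y, z}, {x, a, b}, {y, a, c}, {z, b, c}}" by simp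
qed simp

text \<open>A set closed under the four added blocks meets the six points in at most one point, in a
  pair that the switch leaves out, in a single added block, or in all six. Only a single added block
  violates closure under the removed ones, and \<open>n1\<close> to \<open>n4\<close> exclude
  it.\<close>

lemma closed_of_pasch_switch:
  assumes sts: "sts V B"
    and R: "{{x, y, z}, {x, a, b}, {y, a, c}, {z, b, c}} \<subseteq> B"
    and closed: "sub_closed (pasch_switch B x y z a b c) W"
    and n1: "\<not> (x \<in> W \<and> y \<in> W \<and> a \<in> W \<and> z \<notin> W \<and> b \<notin> W \<and> c \<notin> W)"
    and n2: "\<not> (x \<in> W \<and> z \<in> W \<and> b \<in> W \<and> y \<notin> W \<and> a \<notin> W \<and> c \<notin> W)"
    and n3: "\<not> (y \<in> W \<and> z \<in> W \<and> c \<in> W \<and> x \<notin> W \<and> a \<notin> W \<and> b \<notin> W)"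
    and n4: "\<not> (a \<in> W \<and> b \<in> W \<and> c \<in> W \<and> x \<notin> W \<and> y \<notin> W \<and> z \<notin> W)"
  shows "sub_closed B W"
  unfolding sub_closed_def
proof (intro allI impI)
  fix p q r assume b: "{p, q, r} \<in> B" and W: "p \<in> W" "q \<in> W"
  have two: "(u \<in> W \<and> v \<in> W \<longrightarrow> w \<in> W) \<and> (u \<in> W \<and> w \<in> W \<longrightarrow> v \<in> W) \<and>
      (v \<in> W \<and> w \<in> W \<longrightarrow> u \<in> W)"
    if "{u, v, w} \<in> pasch_switch B x y z a b c" for u v w
    using sub_closedD[OF closed, of u v w] sub_closedD[OF closed, of u w v]
      sub_closedD[OF closed, of v w u] that by (simp add: insert_commute)
  have l: "{x, y, a} \<in> pasch_switch B x y z a b c" "{x, z, b} \<in> pasch_switch B x y z a b c"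
    "{y, z, c} \<in> pasch_switch B x y z a b c" "{a, b, c} \<in> pasch_switch B x y z a b c"
    unfolding pasch_switch_def by auto
  note L = two[OF l(1)] two[OF l(2)] two[OF l(3)] two[OF l(4)]
  have d: "p \<noteq> q" "r \<noteq> p" "r \<noteq> q" using sts_distinct[OF sts b] by auto
  have meets: "u \<in> W \<and> v \<in> W \<or> u \<in> W \<and> w \<in> W \<or> v \<in> W \<and> w \<in> W"
    "u \<in> W \<and> v \<in> W \<and> w \<in> W \<longrightarrow> r \<in> W" if "{p, q, r} = {u, v, w}" for u v w
  proof -
    have "p \<in> {u, v, w}" "q \<in> {u, v, w}" "r \<in> {u, v, w}"
      unfolding that[symmetric] by simp_all
    then show "u \<in> W \<and> v \<in> W \<or> u \<in> W \<and> w \<in> W \<or> v \<in> W \<and> w \<in> W"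
      "u \<in> W \<and> v \<in> W \<and> w \<in> W \<longrightarrow> r \<in> W" using d W by auto
  qed
  show "r \<in> W"
  proof (cases "{p, q, r} \<in> {{x, y, z}, {x, a, b}, {y, a, c}, {z, b, c}}")
    case False
    then have "{p, q, r} \<in> pasch_switch B x y z a b c" using b unfolding pasch_switch_def by blast
    then show ?thesis using two W by blast
  next
    case True
    then consider "{p, q, r} = {x, y, z}" | "{p, q, r} = {x, a, b}" | "{p, q, r} = {y, a, c}"
      | "{p, q, r} = {z, b, c}" by (metis insertE emptyE)
    then show ?thesis
    proof cases
      case 1
      show ?thesis using meets[OF 1] L n1 n2 n3 n4 by argo
    next
      case 2
      show ?thesis using meets[OF 2] L n1 n2 n3 n4 by argo
    next
      case 3
      show ?thesis using meets[OF 3] L n1 n2 n3 n4 by argo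
    next
      case 4
      show ?thesis using meets[OF 4] L n1 n2 n3 n4 by argo
    qed
  qed
qed

text \<open>Count the third points of the blocks through a point of the exceptional line \<open>{u, v, a}\<close>
  and through a point off that line.\<close>

lemma no_exceptional_line:
  assumes sts: "sts V D" and W: "W \<subseteq> V" "finite W" "card W > 3" "sub_closed D W"
    and line: "{u, v, a} \<in> D" "{u, v, a} \<subseteq> W" "a \<notin> X" "u \<in> X \<longleftrightarrow> v \<in> X"
    and mixed: "\<And>p q r. {p, q, r} \<in> D \<Longrightarrow> {p, q, r} \<subseteq> W \<Longrightarrow> p \<notin> X \<Longrightarrow> {p, q, r} \<noteq> {u, v, a} \<Longrightarrow>
      q \<in> X \<longleftrightarrow> r \<notin> X"
  shows False
proof -
  let ?L = "{u, v, a}"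
  define P where "P = W \<inter> X"
  define N where "N = W - X"
  have fin: "finite P" "finite N" using W(2) by (auto simp: P_def N_def)
  have dist: "u \<noteq> v" "u \<noteq> a" "v \<noteq> a" using sts_distinct[OF sts line(1)] by auto
  \<comment> \<open>Apart from the line \<open>?L\<close>, each block inside \<open>W\<close>
    through a point of \<open>N\<close> has one further point in \<open>N\<close> and one in
    \<open>P\<close>.\<close>
  have third: "r \<in> W" "r \<in> X \<longleftrightarrow> q \<notin> X" "r \<noteq> p"
    if "{p, q, r} \<in> D" "p \<in> N" "q \<in> W" "p \<notin> ?L \<or> q \<notin> ?L" for p q r
  proof -
    show r: "r \<in> W" using sub_closedD[OF W(4) that(1)] that N_def by blast
    have "{p, q, r} \<noteq> ?L" using that(4) by blast
    then show "r \<in> X \<longleftrightarrow> q \<notin> X" using mixed[OF that(1)] r that N_def by blast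
    show "r \<noteq> p" using sts_distinct[OF sts that(1)] by simp
  qed
  have a: "a \<in> N" using line N_def by simp
  have off: "r \<notin> ?L" if "{a, q, r} \<in> D" "q \<notin> ?L" for q r
  proof
    assume "r \<in> ?L"
    moreover have "{a, u, v} \<in> D" "{a, v, u} \<in> D" using line(1) by (simp_all add: insert_commute)
    moreover have "{a, r, q} \<in> D" using that(1) by (simp add: insert_commute)
    ultimately have "q \<in> ?L"
      using sts_unique_third[OF sts] sts_distinct(2)[OF sts that(1)] by blast
    with that(2) show False by simp
  qed
  \<comment> \<open>The blocks through \<open>a\<close> other than the line pair off what remains of
    \<open>P\<close> and \<open>N\<close>.\<close>
  have "card (P - ?L) = card (N - ?L)"
  proof (rule card_eq_of_third[OF sts, of _ _ a])
    show "r \<in> N - ?L" if "q \<in> P - ?L" "{a, q, r} \<in> D" for q r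
      using third[OF that(2) a] off[OF that(2)] that(1) by (auto simp: P_def N_def)
    show "r \<in> P - ?L" if "q \<in> N - ?L" "{a, q, r} \<in> D" for q r
      using third[OF that(2) a] off[OF that(2)] that(1) by (auto simp: P_def N_def)
  qed (use W(1) a in \<open>auto simp: P_def N_def\<close>)
  note card_a = this
  have "\<not> W \<subseteq> ?L"
  proof
    assume "W \<subseteq> ?L"
    then have "card W \<le> card ?L" by (intro card_mono) simp_all
    then show False using W(3) dist by simp
  qed
  then obtain w where w: "w \<in> W" "w \<notin> ?L" by blast
  \<comment> \<open>If \<open>w\<close> lies in \<open>X\<close>, the third point of its block with
    \<open>a\<close> is in \<open>N\<close>, and it is off the line as \<open>w\<close> is.\<close>
  obtain p where p: "p \<in> N" "p \<notin> ?L"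
  proof (cases "w \<in> X")
    case True
    obtain r where r: "{a, w, r} \<in> D"
      using sts_ex_third[OF sts, of a w] w line(2) W(1) by blast
    then have "r \<in> N" using third(1,2)[OF r a w(1)] w(2) True by (auto simp: N_def)
    then show thesis using that off[OF r w(2)] by blast
  next
    case False
    then show thesis using that w by (simp add: N_def)
  qed
  have "card P = card (N - {p})"
  proof (rule card_eq_of_third[OF sts, of _ _ p])
    show "r \<in> N - {p}" if "q \<in> P" "{p, q, r} \<in> D" for q r
      using third[OF that(2) p(1)] p(2) that(1) by (auto simp: P_def N_def)
    show "r \<in> P" if "q \<in> N - {p}" "{p, q, r} \<in> D" for q r
      using third[OF that(2) p(1)] p(2) that(1) by (auto simp: P_def N_def)
  qed (use W(1) p in \<open>auto simp: P_def N_def\<close>)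
  then have card_p: "card P = card N - 1" using p(1) by simp
  \<comment> \<open>If \<open>u\<close> and \<open>v\<close> lie in \<open>X\<close>, the count
    through \<open>a\<close> gives \<open>card P = card N + 1\<close>, otherwise
    \<open>card P = card N - 3\<close>. Both contradict the count through \<open>p\<close>.\<close>
  show False
  proof (cases "u \<in> X")
    case True
    then have "{u, v} \<subseteq> P" "P - ?L = P - {u, v}" "N - ?L = N - {a}"
      using line a by (auto simp: P_def N_def)
    moreover have "card {u, v} \<le> card P" using calculation fin by (intro card_mono) simp_all
    ultimately show False
      using card_a card_p a fin dist card_Diff_subset[of "{u, v}" P] by simp
  next
    case False
    then have "insert p ?L \<subseteq> N" "?L \<subseteq> N" "P - ?L = P"
      using line a p by (auto simp: P_def N_def)
    moreover have "card (insert p ?L) \<le> card N" using calculation fin by (intro card_mono) simp_all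
    moreover have "card (insert p ?L) = 4" "card ?L = 3" using p(2) dist by auto
    ultimately show False
      using card_a card_p card_Diff_subset[of ?L N] by simp
  qed
qed

section \<open>Removing unwanted blocks by doubling and switching\<close>

text \<open>After the switch the block through two of \<open>x\<close>, \<open>y\<close>,
  \<open>z\<close> has a new third point, so a closed set of old points contains at most one of
  them. For larger closed sets \<open>no_exceptional_line\<close> excludes the bad cases of the
  switch. The bound \<open>small\<close> keeps the added blocks from being three-point
  cosets.\<close>

lemma generic_pasch_doubling:
  assumes sts: "sts {..<n} B" and odd: "odd n"
    and t: "{x, y, z} \<in> B" and small: "\<forall>u\<in>{x, y, z}. 3 * u + 3 \<le> 2 * n + 1"
  obtains D where "sts {..<2 * n + 1} D" "B - {{x, y, z}} \<subseteq> D"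
    "\<And>b. b \<in> D \<Longrightarrow> b \<subseteq> {..<n} \<Longrightarrow> b \<in> B - {{x, y, z}}"
    "generic (2 * n + 1) D"
    "\<And>W. W \<subseteq> {..<2 * n + 1} \<Longrightarrow> card W > 3 \<Longrightarrow> \<not> W \<subseteq> {..<n} \<Longrightarrow> sub_closed D W
       \<Longrightarrow> sub_closed (doubling n B) W"
    "\<And>W. W \<subseteq> {..<n} \<Longrightarrow> sub_closed D W \<Longrightarrow> sub_closed B W \<and> \<not> {x, y, z} \<subseteq> W"
proof -
  have n0: "n > 0" using odd by (cases n) auto
  have xyz: "x < n" "y < n" "z < n" "x \<noteq> y" "x \<noteq> z" "y \<noteq> z"
    using sts_distinct[OF sts t] by auto
  \<comment> \<open>Modulo \<open>n\<close>, these residues satisfy \<open>a0 + b0 = 2 * x\<close>,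
    \<open>a0 + c0 = 2 * y\<close> and \<open>b0 + c0 = 2 * z\<close>, so the reflections at
    \<open>x\<close>, \<open>y\<close>, \<open>z\<close> complete the block to a Pasch
    configuration.\<close>
  obtain a0 where a0: "a0 < n" "int n dvd (int x + int y - int z) - int a0" using ex_residue[OF n0] .
  obtain b0 where b0: "b0 < n" "int n dvd (int x + int z - int y) - int b0" using ex_residue[OF n0] .
  obtain c0 where c0: "c0 < n" "int n dvd (int y + int z - int x) - int c0" using ex_residue[OF n0] .
  have sum: "int n dvd u + v - 2 * w"
    if "int n dvd e - u" "int n dvd f - v" "e + f = 2 * w" for e f u v w :: int
  proof -
    have "u + v - 2 * w = - ((e - u) + (f - v))" using that(3) by simp
    then show ?thesis using that(1,2) by (metis dvd_add dvd_minus_iff)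
  qed
  have diff: "k \<noteq> l"
    if "int n dvd e - int k" "int n dvd f - int l" "e - f = 2 * (int u - int v)" "u \<noteq> v" "u < n" "v < n"
    for e f k l u v
  proof
    assume "k = l"
    then have "int n dvd (e - int k) - (f - int k)" using that(1,2) by (simp only: dvd_diff)
    then have "int n dvd 2 * (int u - int v)" using that(3) by simp
    then show False using residue_unique[OF odd_dvd_double[OF odd]] that by blast
  qed
  define a where "a = n + a0"
  define b where "b = n + b0"
  define c where "c = n + c0"
  have ab: "a0 \<noteq> b0" by (rule diff[OF a0(2) b0(2), of y z]) (use xyz in simp_all)
  have ac: "a0 \<noteq> c0" by (rule diff[OF a0(2) c0(2), of x z]) (use xyz in simp_all)
  have bc: "b0 \<noteq> c0" by (rule diff[OF b0(2) c0(2), of x y]) (use xyz in simp_all)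
  let ?E = "doubling n B"
  note E = sts_doubling[OF sts odd]
  have old: "{x, y, z} \<in> ?E" using doubling_oldI[OF t] .
  have new: "{x, a, b} \<in> ?E" "{y, a, c} \<in> ?E" "{z, b, c} \<in> ?E"
    unfolding a_def b_def c_def
    by (rule doubling_reflectionI[OF _ a0(1) b0(1) ab sum[OF a0(2) b0(2)]]
          doubling_reflectionI[OF _ a0(1) c0(1) ac sum[OF a0(2) c0(2)]]
          doubling_reflectionI[OF _ b0(1) c0(1) bc sum[OF b0(2) c0(2)]]; use xyz in simp)+
  have abc: "n \<le> a" "n \<le> b" "n \<le> c" "a \<noteq> b" "a \<noteq> c" "b \<noteq> c"
    using ab ac bc by (auto simp: a_def b_def c_def)
  have R: "{{x, y, z}, {x, a, b}, {y, a, c}, {z, b, c}} \<subseteq> ?E" using old new by simp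
  define D where "D = pasch_switch ?E x y z a b c"
  have D: "sts {..<2 * n + 1} D"
    unfolding D_def by (rule sts_pasch_switch[OF E _ R]) (use xyz abc in auto)
  define T where "T = {{x, y, a}, {x, z, b}, {y, z, c}, {a, b, c}}"
  have D_cases: "e \<in> ?E \<and> e \<noteq> {x, y, z} \<or> e \<in> T"
    if "e \<in> D" for e
    using that unfolding D_def pasch_switch_def T_def[symmetric] by (metis DiffE UnE insertI1)
  have T_new: "\<not> e \<subseteq> {..<n}" if "e \<in> T" for e
    using that abc unfolding T_def by (elim insertE emptyE) simp_all
  have lines: "{x, y, a} \<in> D" "{x, z, b} \<in> D" "{y, z, c} \<in> D" "{a, b, c} \<in> D"
    unfolding D_def pasch_switch_def by auto
  have mixed: "q < n \<longleftrightarrow> \<not> r < n" if e: "{p, q, r} \<in> ?E" "\<not> p < n" for p q r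
  proof -
    have "{p, q, r} \<notin> B" using sts_distinct(4)[OF sts, of p q r] e(2) by auto
    then obtain i p' q' where i: "{p, q, r} = {i, p', q'}" "i < n" "n \<le> p'" "n \<le> q'" "p' \<noteq> q'"
      using doubling_mixed[OF e(1)] by metis
    have "p \<in> {i, p', q'}" "q \<in> {i, p', q'}" "r \<in> {i, p', q'}"
      unfolding i(1)[symmetric] by simp_all
    moreover have "i \<in> {p, q, r}" unfolding i(1) by simp
    ultimately show ?thesis using e(2) i(2-4) sts_distinct(3)[OF E e(1)] by auto
  qed
  have B_old: "e \<subseteq> {..<n}" if "e \<in> B" for e using sts_block(1)[OF sts that] .
  have in_B: "e \<in> B - {{x, y, z}}" if "e \<in> D" "e \<subseteq> {..<n}" for e
  proof -
    have "e \<notin> T" using that(2) T_new by metis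
    then have e: "e \<in> ?E" "e \<noteq> {x, y, z}" using D_cases[OF that(1)] by metis+
    have "e \<in> B"
    proof (rule ccontr)
      assume "e \<notin> B"
      then obtain i p q where "e = {i, p, q}" "n \<le> p" using doubling_mixed[OF e(1)] by metis
      then show False using that(2) by auto
    qed
    with e show ?thesis by simp
  qed
  have B_sub: "B - {{x, y, z}} \<subseteq> D"
  proof
    fix e assume e: "e \<in> B - {{x, y, z}}"
    have "e = {x, y, z}" if "e \<in> {{x, y, z}, {x, a, b}, {y, a, c}, {z, b, c}}"
      using that B_old[of e] e abc by (elim insertE emptyE) simp_all
    then show "e \<in> D" using e doubling_oldI[of e B n] unfolding D_def pasch_switch_def
      by (metis DiffE DiffI UnI1 singletonI)
  qed
  have in_D: "e \<in> D" if "e \<in> B" "e \<noteq> {x, y, z}" for e using B_sub that by auto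
  show thesis
  proof (rule that[OF D B_sub in_B])
    fix W assume W: "W \<subseteq> {..<n}" "sub_closed D W"
    have "\<not> (x \<in> W \<and> y \<in> W)" "\<not> (x \<in> W \<and> z \<in> W)" "\<not> (y \<in> W \<and> z \<in> W)"
      using sub_closedD[OF W(2) lines(1)] sub_closedD[OF W(2) lines(2)]
        sub_closedD[OF W(2) lines(3)] W(1) abc(1-3) by auto
    note no_two = this
    have "sub_closed B W"
      unfolding sub_closed_def
    proof (intro allI impI)
      fix p q r assume b: "{p, q, r} \<in> B" "p \<in> W" "q \<in> W"
      have "{p, q, r} \<noteq> {x, y, z}"
      proof
        assume eq: "{p, q, r} = {x, y, z}"
        have "p \<in> {x, y, z}" "q \<in> {x, y, z}" unfolding eq[symmetric] by simp_all
        then show False using no_two b(2,3) sts_distinct(1)[OF sts b(1)] by auto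
      qed
      from in_D[OF b(1) this] have "{p, q, r} \<in> D" .
      then show "r \<in> W" using sub_closedD[OF W(2)] b by blast
    qed
    then show "sub_closed B W \<and> \<not> {x, y, z} \<subseteq> W" using no_two by simp
  next
    show reduce: "sub_closed ?E W" if W: "W \<subseteq> {..<2 * n + 1}" "card W > 3" "\<not> W \<subseteq> {..<n}"
      and closed: "sub_closed D W" for W
    proof (rule closed_of_pasch_switch[OF E R closed[unfolded D_def]])
      have fW: "finite W" using W(1) finite_subset by blast
      \<comment> \<open>Here \<open>{u, v, w}\<close> is the only added block inside
        \<open>W\<close>. Any other block of \<open>D\<close> inside \<open>W\<close> comes from the
        doubling, so if it has a new point it has exactly one old point.\<close>
      have new_line: False
        if L: "{u, v, w} \<in> T" "{u, v, w} \<subseteq> W"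
          and w: "n \<le> w" "u < n \<longleftrightarrow> v < n"
          and others: "\<And>e. e \<in> T \<Longrightarrow> e \<subseteq> W \<Longrightarrow> e = {u, v, w}"
        for u v w
      proof (rule no_exceptional_line[OF D W(1) fW W(2) closed _ L(2), of "{..<n}"])
        show "{u, v, w} \<in> D" using L(1) unfolding D_def pasch_switch_def T_def by (rule UnI2)
        show "w \<notin> {..<n}" "u \<in> {..<n} \<longleftrightarrow> v \<in> {..<n}" using w by simp_all
        fix p q r assume e: "{p, q, r} \<in> D" "{p, q, r} \<subseteq> W" "p \<notin> {..<n}" "{p, q, r} \<noteq> {u, v, w}"
        then have "{p, q, r} \<in> ?E" using D_cases others by metis
        then show "q \<in> {..<n} \<longleftrightarrow> r \<notin> {..<n}" using mixed[of p q r] e(3) by simp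
      qed
      show "\<not> (x \<in> W \<and> y \<in> W \<and> a \<in> W \<and> z \<notin> W \<and> b \<notin> W \<and> c \<notin> W)" (is "\<not> ?H")
      proof (rule notI)
        assume H: ?H
        show False
        proof (rule new_line[of x y a])
          show "e = {x, y, a}" if "e \<in> T" "e \<subseteq> W" for e
            using that H unfolding T_def by (elim insertE emptyE) simp_all
        qed (use H xyz abc in \<open>simp_all add: T_def\<close>)
      qed
      show "\<not> (x \<in> W \<and> z \<in> W \<and> b \<in> W \<and> y \<notin> W \<and> a \<notin> W \<and> c \<notin> W)" (is "\<not> ?H")
      proof (rule notI)
        assume H: ?H
        show False
        proof (rule new_line[of x z b])
          show "e = {x, z, b}" if "e \<in> T" "e \<subseteq> W" for e
            using that H unfolding T_def by (elim insertE emptyE) simp_all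
        qed (use H xyz abc in \<open>simp_all add: T_def\<close>)
      qed
      show "\<not> (y \<in> W \<and> z \<in> W \<and> c \<in> W \<and> x \<notin> W \<and> a \<notin> W \<and> b \<notin> W)" (is "\<not> ?H")
      proof (rule notI)
        assume H: ?H
        show False
        proof (rule new_line[of y z c])
          show "e = {y, z, c}" if "e \<in> T" "e \<subseteq> W" for e
            using that H unfolding T_def by (elim insertE emptyE) simp_all
        qed (use H xyz abc in \<open>simp_all add: T_def\<close>)
      qed
      show "\<not> (a \<in> W \<and> b \<in> W \<and> c \<in> W \<and> x \<notin> W \<and> y \<notin> W \<and> z \<notin> W)" (is "\<not> ?H")
      proof (rule notI)
        assume H: ?H
        show False
        proof (rule new_line[of a b c])
          show "e = {a, b, c}" if "e \<in> T" "e \<subseteq> W" for e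
            using that H unfolding T_def by (elim insertE emptyE) simp_all
        qed (use H xyz abc in \<open>simp_all add: T_def\<close>)
      qed
    qed
    show "generic (2 * n + 1) D"
    proof (rule generic_doublingI[OF sts odd D reduce])
      fix r m assume m: "3 * m = 2 * n + 1" "r < m"
      show "{r, r + m, r + 2 * m} \<notin> D"
      proof
        assume d: "{r, r + m, r + 2 * m} \<in> D"
        have "n \<ge> 3" using xyz by linarith
        have xyz_m: "x < m" "y < m" "z < m" using small m(1) by auto
        have ge: "n \<le> r + 2 * m" "r < n" "0 < m" using m \<open>n \<ge> 3\<close> by linarith+
        \<comment> \<open>The coset has exactly one point below \<open>m\<close>, and this point is
          old; an added block has two points below \<open>m\<close> or consists of new
          points.\<close>
        have "{r, r + m, r + 2 * m} \<notin> T"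
        proof
          assume "{r, r + m, r + 2 * m} \<in> T"
          then obtain u v w where uvw: "{r, r + m, r + 2 * m} = {u, v, w}"
            "u < m \<and> v < m \<or> n \<le> u \<and> n \<le> v \<and> n \<le> w"
            using xyz_m abc unfolding T_def by (metis empty_iff insert_iff)
          have "r \<in> {u, v, w}" "r + m \<in> {u, v, w}" "r + 2 * m \<in> {u, v, w}"
            unfolding uvw(1)[symmetric] by simp_all
          then show False using ge uvw(2) by auto
        qed
        then show False using D_cases[OF d] doubling_no_coset_line[OF sts \<open>n \<ge> 3\<close> m] by simp
      qed
    qed
  qed
qed

text \<open>Induction on the unwanted blocks, one switched doubling for each. Genericity is carried
  along, so that a nontrivial closed set reaching the new points is everything.\<close>

lemma eliminate_blocks:
  assumes Z: "sts {..<s} Z" "odd s" "s \<ge> 3" "generic s Z" and K: "finite K" "K \<subseteq> Z"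
  shows "\<exists>n B. odd n \<and> 2 * s + 1 \<le> n \<and> sts {..<n} B \<and> generic n B \<and> Z - K \<subseteq> B \<and>
    (\<forall>W. W \<subseteq> {..<n} \<longrightarrow> card W > 3 \<longrightarrow> sub_closed B W \<longrightarrow> W \<noteq> {..<n} \<longrightarrow>
      W \<subseteq> {..<s} \<and> (\<forall>b\<in>B. b \<subseteq> W \<longrightarrow> b \<in> Z - K))"
  using K
proof (induction K rule: finite_induct)
  case empty
  have old: "b \<in> Z" if b: "b \<in> doubling s Z" "b \<subseteq> {..<s}" for b
  proof (rule ccontr)
    assume "b \<notin> Z"
    then obtain i p q where "b = {i, p, q}" "s \<le> p" using doubling_mixed[OF b(1)] by metis
    then show False using b(2) by auto
  qed
  show ?case
  proof (intro exI[of _ "2 * s + 1"] exI[of _ "doubling s Z"] conjI allI impI)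
    fix W assume W: "W \<subseteq> {..<2 * s + 1}" "card W > 3" "sub_closed (doubling s Z) W"
      "W \<noteq> {..<2 * s + 1}"
    show *: "W \<subseteq> {..<s}"
      using generic_closed_doubling[OF Z(1,2,4) W(1,2) _ W(3)] W(4) by blast
    show "\<forall>b\<in>doubling s Z. b \<subseteq> W \<longrightarrow> b \<in> Z - {}" using old * by blast
  next
    show "Z - {} \<subseteq> doubling s Z" using doubling_oldI by blast
  qed (simp_all add: sts_doubling[OF Z(1,2), simplified] generic_doubling[OF Z(1-3), simplified])
next
  case (insert t K)
  then have t: "t \<in> Z" "t \<notin> K" and "K \<subseteq> Z" by auto
  from insert.IH[OF \<open>K \<subseteq> Z\<close>] obtain n B where n: "odd n" "2 * s + 1 \<le> n" "sts {..<n} B" "generic n B"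
    and sub: "Z - K \<subseteq> B"
    and ctrl: "\<forall>W. W \<subseteq> {..<n} \<longrightarrow> card W > 3 \<longrightarrow> sub_closed B W \<longrightarrow> W \<noteq> {..<n} \<longrightarrow>
      W \<subseteq> {..<s} \<and> (\<forall>b\<in>B. b \<subseteq> W \<longrightarrow> b \<in> Z - K)"
    by (elim exE conjE)
  note ctrl = ctrl[rule_format]
  obtain x y z where xyz: "t = {x, y, z}" using sts_block(2)[OF Z(1) t(1)] by (auto simp: card_3_iff)
  have ts: "t \<subseteq> {..<s}" using sts_block(1)[OF Z(1) t(1)] .
  have tB: "{x, y, z} \<in> B" using t sub xyz by blast
  \<comment> \<open>The points of \<open>t\<close> are below \<open>s\<close>, and the current stage
    has at least \<open>2 * s + 1\<close> points, so \<open>t\<close> lies in the lowest third of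
    the next point set.\<close>
  have small: "\<forall>u\<in>{x, y, z}. 3 * u + 3 \<le> 2 * n + 1" using ts n(2) xyz by auto
  obtain D where
    D: "sts {..<2 * n + 1} D" "B - {t} \<subseteq> D"
    and old: "\<And>b. b \<in> D \<Longrightarrow> b \<subseteq> {..<n} \<Longrightarrow> b \<in> B - {t}"
    and gen: "generic (2 * n + 1) D"
    and new: "\<And>W. W \<subseteq> {..<2 * n + 1} \<Longrightarrow> card W > 3 \<Longrightarrow> \<not> W \<subseteq> {..<n} \<Longrightarrow> sub_closed D W
       \<Longrightarrow> sub_closed (doubling n B) W"
    and red: "\<And>W. W \<subseteq> {..<n} \<Longrightarrow> sub_closed D W \<Longrightarrow> sub_closed B W \<and> \<not> t \<subseteq> W"
    by (rule generic_pasch_doubling[OF n(3,1) tB small, folded xyz]; rule that; blast)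
  show ?case
  proof (intro exI[of _ "2 * n + 1"] exI[of _ D] conjI allI impI)
    show "Z - insert t K \<subseteq> D" using sub D(2) by blast
    fix W assume W: "W \<subseteq> {..<2 * n + 1}" "card W > 3" "sub_closed D W" "W \<noteq> {..<2 * n + 1}"
    have Wn: "W \<subseteq> {..<n}"
      using generic_closed_doubling[OF n(3,1,4) W(1,2) _ new[OF W(1,2) _ W(3)]] W(4) by blast
    note r = red[OF Wn W(3)]
    \<comment> \<open>The former point set contains \<open>t\<close> and is thus no longer closed,
      so the induction hypothesis applies to \<open>W\<close>.\<close>
    have "W \<noteq> {..<n}" using r sts_block(1)[OF n(3) tB] xyz by auto
    then have c: "W \<subseteq> {..<s}" "\<And>b. b \<in> B \<Longrightarrow> b \<subseteq> W \<Longrightarrow> b \<in> Z - K"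
      using ctrl[OF Wn W(2) conjunct1[OF r]] by simp_all
    show "W \<subseteq> {..<s}" by (fact c)
    show "\<forall>b\<in>D. b \<subseteq> W \<longrightarrow> b \<in> Z - insert t K"
    proof (intro ballI impI)
      fix b assume b: "b \<in> D" "b \<subseteq> W"
      have "b \<in> B" "b \<noteq> t" using old[OF b(1) subset_trans[OF b(2) Wn]] by simp_all
      then show "b \<in> Z - insert t K" using c(2)[of b] b(2) by simp
    qed
  qed (use n(1,2) D gen in \<open>simp_all add: lessThan_Suc_atMost\<close>)
qed

section \<open>Embedding a partial system in a complete one\<close>

text \<open>Trading three blocks \<open>{x, y, a}\<close>, \<open>{x, z, b}\<close>, \<open>{y, z, c}\<close> for \<open>{x, y, z}\<close> leaves the
  hexagon \<open>x b z c y a\<close> uncovered. Its edges are joined to new points; the pairs of new points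
  that this sets free form two triangles if \<open>x + y + z = a + b + c\<close>, whence the labels
  \<open>(x, y, z, a, b, c) = (10, 14, 15, 11, 12, 16)\<close>.\<close>

lemma doubling_hexagon_trade:
  fixes n :: nat
  assumes sts: "sts {..<n} B" and n: "odd n" "n \<ge> 21"
    and B: "{10, 14, 11} \<in> B" "{10, 15, 12} \<in> B" "{14, 15, 16} \<in> B"
  shows "\<exists>D. sts {..<2 * n + 1} D \<and> B - {{10, 14, 11}, {10, 15, 12}, {14, 15, 16}} \<subseteq> D \<and>
    {10, 14, 15} \<in> D"
proof -
  \<comment> \<open>Along the hexagon 12, 15, 16, 14, 11, 10 the reflection blocks use the new
    points 13, 11, 19, 13, 15, 7, 13 in turn. In \<open>L\<close> each edge takes the new point
    shared by the blocks at its ends, and two triangles at 13 cover the freed pairs.\<close>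
  define R where "R = {{10, 14, 11}, {10, 15, 12}, {14, 15, 16}, {12, n + 13, n + 11},
    {15, n + 11, n + 19}, {16, n + 19, n + 13}, {14, n + 13, n + 15}, {11, n + 15, n + 7},
    {10, n + 7, n + 13}}"
  define L where "L = [{10, 14, 15}, {10, 12, n + 13}, {12, 15, n + 11}, {15, 16, n + 19},
    {16, 14, n + 13}, {14, 11, n + 15}, {11, 10, n + 7}, {n + 13, n + 11, n + 19},
    {n + 13, n + 15, n + 7}]"
  let ?E = "doubling n B"
  \<comment> \<open>The midpoint condition is an equation of integers here, so the same labels serve
    every odd \<open>n \<ge> 21\<close>.\<close>
  have refl: "{i, n + j, n + k} \<in> ?E" if "i < 21" "j < 21" "k < 21" "j \<noteq> k" "j + k = 2 * i" for i j k
    using that n(2) by (intro doubling_reflectionI) (simp_all flip: of_nat_add)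
  have R: "R \<subseteq> ?E" unfolding R_def
    using B[THEN doubling_oldI] refl by simp
  have "sts {..<2 * n + 1} (?E - R \<union> set L)"
  proof (rule sts_trade[OF sts_doubling[OF sts n(1)] _ R])
    show "b \<subseteq> {..<2 * n + 1} \<and> card b = 3" if "b \<in> set L" for b
      using that n(2) unfolding L_def list.set
      by (elim insertE emptyE) (simp_all add: card_3_distinct)
    show "\<exists>c\<in>set L. {p, q} \<subseteq> c" if e: "b \<in> R" "p \<in> b" "q \<in> b" "p \<noteq> q" for b p q
    proof -
      have "list_ex (\<lambda>c. p \<in> c \<and> q \<in> c) L"
        using e(1) unfolding R_def L_def
        by (elim insertE emptyE) (use e(2-4) in auto)
      then show ?thesis by (auto simp: list_ex_iff)
    qed
    \<comment> \<open>The blocks of \<open>R\<close> are told apart by the sums of their points,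
      which gives nine of them.\<close>
    have "(\<lambda>b. \<Sum>b) ` R = {35, 37, 45, 36 + 2 * n, 45 + 2 * n, 48 + 2 * n, 42 + 2 * n,
        33 + 2 * n, 30 + 2 * n}"
      unfolding R_def using n(2) by (simp add: insert_commute)
    moreover have "card \<dots> = 9" using n(2) by simp
    ultimately have "9 \<le> card R"
      using card_image_le[of R "\<lambda>b. \<Sum>b"] unfolding R_def by simp
    moreover have "card (set L) \<le> 9" using card_length[of L] by (simp add: L_def)
    ultimately show "card (set L) \<le> card R" by linarith
  qed simp_all
  moreover have "B - {{10, 14, 11}, {10, 15, 12}, {14, 15, 16}} \<subseteq> ?E - R \<union> set L"
  proof
    fix e assume e: "e \<in> B - {{10, 14, 11}, {10, 15, 12}, {14, 15, 16}}"
    have "e \<in> {{10, 14, 11}, {10, 15, 12}, {14, 15, 16}}" if "e \<in> R"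
      using that sts_block(1)[OF sts, of e] e unfolding R_def by (elim insertE emptyE) simp_all
    then have "e \<notin> R" using e by blast
    then show "e \<in> ?E - R \<union> set L" using e doubling_oldI[of e B n] by (metis DiffD1 DiffI UnI1)
  qed
  moreover have "{10, 14, 15} \<in> ?E - R \<union> set L" unfolding L_def by simp
  ultimately show ?thesis by blast
qed

lemma extend_to_bij:
  assumes "finite V" "S \<subseteq> V" "inj_on f S" "f ` S \<subseteq> {..<card V}"
  obtains g where "bij_betw g V {..<card V}" "\<And>s. s \<in> S \<Longrightarrow> g s = f s"
proof -
  have fS: "finite S" using assms finite_subset by blast
  have "card (V - S) = card ({..<card V} - f ` S)"
    using assms fS by (simp add: card_Diff_subset card_image)
  then obtain h where h: "bij_betw h (V - S) ({..<card V} - f ` S)"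
    using finite_same_card_bij[of "V - S" "{..<card V} - f ` S"] assms(1) by auto
  define g where "g v = (if v \<in> S then f v else h v)" for v
  have "bij_betw g S (f ` S)"
    using inj_on_imp_bij_betw[OF assms(3)] by (rule bij_betw_cong[THEN iffD1, rotated]) (simp add: g_def)
  moreover have "bij_betw g (V - S) ({..<card V} - f ` S)"
    using h by (rule bij_betw_cong[THEN iffD1, rotated]) (simp add: g_def)
  ultimately have "bij_betw g (S \<union> (V - S)) (f ` S \<union> ({..<card V} - f ` S))"
    by (rule bij_betw_combine) auto
  then have "bij_betw g V {..<card V}" using assms(2,4) by (simp add: Un_absorb1)
  then show thesis using that g_def by auto
qed

text \<open>Labels from \<open>n\<close> on are sent into the infinite complement of
  \<open>V\<close>. A system grown on \<open>{..<N}\<close> can thus be moved back to the original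
  type with the points of \<open>V\<close> in place.\<close>

lemma extend_inverse:
  fixes V :: "'a set"
  assumes inf: "infinite (UNIV :: 'a set)" and f: "bij_betw f V {..<n::nat}"
  obtains g where "inj_on g {..<N}" "\<And>v. v \<in> V \<Longrightarrow> g (f v) = v"
proof -
  have fin: "finite V" using bij_betw_finite[OF f] by blast
  have "infinite (- V)" using inf fin by (metis Compl_eq_Diff_UNIV Diff_infinite_finite)
  then obtain h :: "nat \<Rightarrow> 'a" where h: "inj h" "range h \<subseteq> - V"
    using infinite_countable_subset by blast
  define g where "g k = (if k < n then inv_into V f k else h k)" for k
  have inv: "inv_into V f k \<in> V" if "k < n" for k
    using f that by (metis bij_betw_def inv_into_into lessThan_iff)
  have inj: "k = l" if "k < n" "l < n" "inv_into V f k = inv_into V f l" for k l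
    using f that by (metis bij_betw_inv_into_right lessThan_iff)
  have "inj_on g {..<N}"
  proof (rule inj_onI)
    fix k l assume eq: "g k = g l"
    have hV: "h i \<notin> V" for i using h(2) by blast
    show "k = l"
      using eq inj[of k l] inv[of k] inv[of l] hV[of k] hV[of l] injD[OF h(1), of k l]
      unfolding g_def by (cases "k < n"; cases "l < n") auto
  qed
  moreover have "g (f v) = v" if "v \<in> V" for v
    using f that by (auto simp: g_def bij_betw_inv_into_left bij_betw_apply dest: bij_betw_apply)
  ultimately show thesis using that by blast
qed

lemma ex_large_sts: "\<exists>n B. (N::nat) \<le> n \<and> odd n \<and> sts {..<n} B"
proof (induction N)
  case 0
  have "sts {..<1::nat} {}" by (rule stsI) auto
  then show ?case by (intro exI[of _ 1]) auto
next
  case (Suc N)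
  then obtain n B where "N \<le> n" "odd n" "sts {..<n} B" by blast
  then show ?case
    using sts_doubling[of n B] by (intro exI[of _ "2 * n + 1"]) auto
qed

lemma image_image_inverse:
  assumes "\<And>v. v \<in> b \<Longrightarrow> g (f v) = v"
  shows "g ` f ` b = b"
  using assms by force

lemma partial_sts_unique:
  assumes "partial_sts U A" "b \<in> A" "c \<in> A" "{p, q} \<subseteq> b" "{p, q} \<subseteq> c" "p \<noteq> q"
  shows "b = c"
proof -
  have "p \<in> U" "q \<in> U" using assms(1,2,4) unfolding partial_sts_def by auto
  then have "\<exists>\<^sub>\<le>\<^sub>1 b. b \<in> A \<and> {p, q} \<subseteq> b" using assms(1,6) unfolding partial_sts_def by simp
  then show ?thesis using assms(2-5) unfolding Uniq_def by simp
qed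

lemma partial_sts_subset: "partial_sts U A \<Longrightarrow> A' \<subseteq> A \<Longrightarrow> partial_sts U A'"
  unfolding partial_sts_def Uniq_def by (meson subsetD)

lemma image_sts_subset:
  assumes "\<And>b. b \<in> A \<Longrightarrow> b \<subseteq> V" "\<And>v. v \<in> V \<Longrightarrow> g (f v) = v" "(`) f ` A \<subseteq> D"
  shows "A \<subseteq> (`) g ` D"
proof
  fix b assume b: "b \<in> A"
  then have "g ` f ` b = b" using assms(1,2) by (intro image_image_inverse) blast
  then show "b \<in> (`) g ` D" using b assms(3) by (metis image_eqI subsetD)
qed

text \<open>A block \<open>t\<close> of the partial system that is still missing is inserted by
  trading away the three blocks on its pairs. None of these belongs to \<open>A\<close>, since it
  would share a pair with \<open>t\<close>, so the blocks gained earlier survive.\<close>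

lemma embed_partial_sts:
  fixes U :: "'a set"
  assumes inf: "infinite (UNIV :: 'a set)" and U: "finite U" and "finite A" "partial_sts U A"
  shows "\<exists>V B. finite V \<and> sts V B \<and> odd (card V) \<and> 21 \<le> card V \<and> U \<subseteq> V \<and> A \<subseteq> B"
  using assms(3,4)
proof (induction A rule: finite_induct)
  case empty
  obtain f where f: "bij_betw f U {..<card U}"
    using ex_bij_betw_finite_nat[OF U] by (auto simp: atLeast0LessThan)
  obtain n B where n: "card U + 21 \<le> n" "odd n" "sts {..<n} B" using ex_large_sts by blast
  obtain g where g: "inj_on g {..<n}" "\<And>v. v \<in> U \<Longrightarrow> g (f v) = v"
    using extend_inverse[OF inf f] by blast
  have "U \<subseteq> g ` {..<n}"
  proof
    fix u assume u: "u \<in> U"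
    then have "f u < n" using bij_betw_apply[OF f] n(1) by force
    then show "u \<in> g ` {..<n}" using g(2)[OF u] by (metis image_eqI lessThan_iff)
  qed
  then show ?case using n g(1) sts_image[OF n(3) g(1)] card_image[OF g(1)]
    by (intro exI[of _ "g ` {..<n}"] exI[of _ "(`) g ` B"]) simp
next
  case (insert t A)
  have pA: "partial_sts U A" using insert.prems by (rule partial_sts_subset) blast
  obtain V B where V: "finite V" "sts V B" "odd (card V)" "21 \<le> card V" "U \<subseteq> V" "A \<subseteq> B"
    using insert.IH[OF pA] by blast
  show ?case
  proof (cases "t \<in> B")
    case True
    then show ?thesis using V by blast
  next
    case False
    have "t \<subseteq> U" "card t = 3" using insert.prems unfolding partial_sts_def by auto
    then obtain x y z where t: "t = {x, y, z}" by (auto simp: card_3_iff)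
    have d: "x \<noteq> y" "x \<noteq> z" "y \<noteq> z" using \<open>card t = 3\<close> t by (simp_all add: card_3_distinct)
    have xyz: "x \<in> V" "y \<in> V" "z \<in> V" using \<open>t \<subseteq> U\<close> V(5) t by auto
    obtain a where a: "{x, y, a} \<in> B" using sts_ex_third[OF V(2) xyz(1,2) d(1)] .
    obtain b where b: "{x, z, b} \<in> B" using sts_ex_third[OF V(2) xyz(1,3) d(2)] .
    obtain c where c: "{y, z, c} \<in> B" using sts_ex_third[OF V(2) xyz(2,3) d(3)] .
    note da = sts_distinct[OF V(2) a] and db = sts_distinct[OF V(2) b] and dc = sts_distinct[OF V(2) c]
    \<comment> \<open>A third point inside \<open>t\<close> would put \<open>t\<close> into
      \<open>B\<close>; equal third points would give two blocks with two common points.\<close>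
    have "a \<noteq> z" using a False t by auto
    moreover have "b \<noteq> y" using b False t by (auto simp: insert_commute)
    moreover have "c \<noteq> x" using c False t by (auto simp: insert_commute)
    moreover have "a \<noteq> b"
      using sts_unique_third[OF V(2), of x a y z] a b d by (auto simp: insert_commute)
    moreover have "a \<noteq> c"
      using sts_unique_third[OF V(2), of y a x z] a c d by (auto simp: insert_commute)
    moreover have "b \<noteq> c"
      using sts_unique_third[OF V(2), of z b x y] b c d by (auto simp: insert_commute)
    ultimately have dist: "distinct [x, y, z, a, b, c]" using d da db dc by auto
    have notA: "e \<notin> A" if "{p, q} \<subseteq> e" "{p, q} \<subseteq> t" "p \<noteq> q" "e \<in> B" for e p q
    proof
      assume "e \<in> A"
      then have "e = t" using partial_sts_unique[OF insert.prems, of e t p q] that by blast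
      then show False using that(4) False by simp
    qed
    \<comment> \<open>These are the labels fixed by \<open>doubling_hexagon_trade\<close>; they fit
      because \<open>card V\<close> is at least 21.\<close>
    define f where "f = (\<lambda>_. 0 :: nat)(x := 10, y := 14, z := 15, a := 11, b := 12, c := 16)"
    have f: "f x = 10" "f y = 14" "f z = 15" "f a = 11" "f b = 12" "f c = 16"
      using dist by (auto simp: f_def)
    obtain \<pi> where \<pi>: "bij_betw \<pi> V {..<card V}"
      and eq: "\<And>s. s \<in> {x, y, z, a, b, c} \<Longrightarrow> \<pi> s = f s"
    proof (rule extend_to_bij[OF V(1), of "{x, y, z, a, b, c}" f])
      show "{x, y, z, a, b, c} \<subseteq> V" using xyz da db dc by simp
      show "inj_on f {x, y, z, a, b, c}"
      proof (rule inj_onI)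
        show "p = q" if "p \<in> {x, y, z, a, b, c}" "q \<in> {x, y, z, a, b, c}" "f p = f q" for p q
          using that by (elim insertE emptyE) (simp_all add: f)
      qed
      show "f ` {x, y, z, a, b, c} \<subseteq> {..<card V}" using V(4) by (simp add: f)
    qed blast
    have pts: "\<pi> x = 10" "\<pi> y = 14" "\<pi> z = 15" "\<pi> a = 11" "\<pi> b = 12" "\<pi> c = 16"
      using eq f by simp_all
    have inj: "inj_on \<pi> V" and onto: "\<pi> ` V = {..<card V}" using \<pi> by (auto simp: bij_betw_def)
    define B0 where "B0 = (`) \<pi> ` B"
    have B0: "sts {..<card V} B0" using sts_image[OF V(2) inj] onto B0_def by simp
    have lines: "\<pi> ` {x, y, a} = {10, 14, 11}" "\<pi> ` {x, z, b} = {10, 15, 12}"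
      "\<pi> ` {y, z, c} = {14, 15, 16}" by (simp_all add: pts)
    have "{10, 14, 11} \<in> B0" "{10, 15, 12} \<in> B0" "{14, 15, 16} \<in> B0"
      unfolding B0_def lines[symmetric] by (rule imageI[OF a] imageI[OF b] imageI[OF c])+
    from doubling_hexagon_trade[OF B0 V(3,4) this] obtain D where
      D: "sts {..<2 * card V + 1} D" "B0 - {{10, 14, 11}, {10, 15, 12}, {14, 15, 16}} \<subseteq> D"
        "{10, 14, 15} \<in> D" by blast
    obtain g where g: "inj_on g {..<2 * card V + 1}" "\<And>v. v \<in> V \<Longrightarrow> g (\<pi> v) = v"
      using extend_inverse[OF inf \<pi>] by blast
    have sub: "e \<subseteq> V" if "e \<in> insert t A" for e
      using that t xyz V(6) sts_block(1)[OF V(2)] by blast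
    have "(`) \<pi> ` insert t A \<subseteq> D"
    proof (intro image_subsetI)
      fix e assume e: "e \<in> insert t A"
      show "\<pi> ` e \<in> D"
      proof (cases "e = t")
        case True
        then show ?thesis using D(3) by (simp add: t pts)
      next
        case False
        then have e: "e \<in> A" "e \<in> B" using e V(6) by auto
        have im: "e = h" if "\<pi> ` e = \<pi> ` h" "h \<in> B" for h
          using inj_on_image_eq_iff[OF inj sts_block(1)[OF V(2) e(2)] sts_block(1)[OF V(2) that(2)]]
            that(1) by blast
        have ne: "\<pi> ` e \<noteq> \<pi> ` h" if "h \<in> B" "{p, q} \<subseteq> h" "{p, q} \<subseteq> t" "p \<noteq> q" for h p q
          using im[OF _ that(1)] notA[OF that(2-4,1)] e(1) by metis
        have "\<pi> ` e \<noteq> \<pi> ` {x, y, a}" "\<pi> ` e \<noteq> \<pi> ` {x, z, b}" "\<pi> ` e \<noteq> \<pi> ` {y, z, c}"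
          by (rule ne[OF a, of x y] ne[OF b, of x z] ne[OF c, of y z]; simp add: t d)+
        then have "\<pi> ` e \<in> B0 - {{10, 14, 11}, {10, 15, 12}, {14, 15, 16}}"
          unfolding lines using e(2) B0_def by simp
        then show ?thesis using D(2) by blast
      qed
    qed
    then have "insert t A \<subseteq> (`) g ` D"
      by (rule image_sts_subset[where f = \<pi> and V = V, rotated 2]) (fact sub, fact g(2))
    moreover have "U \<subseteq> g ` {..<2 * card V + 1}"
    proof
      fix u assume "u \<in> U"
      then have "u \<in> V" using V(5) by blast
      then have "\<pi> u < card V" "g (\<pi> u) = u" using onto g(2) by auto
      then show "u \<in> g ` {..<2 * card V + 1}" by (intro image_eqI[of _ _ "\<pi> u"]) auto
    qed
    ultimately show ?thesis
      using V(4) sts_image[OF D(1) g(1)] card_image[OF g(1)]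
      by (intro exI[of _ "g ` {..<2 * card V + 1}"] exI[of _ "(`) g ` D"]) simp
  qed
qed

section \<open>Assembling the extension without unwanted subsystems\<close>

theorem theorem3:
  fixes U :: "'a set" and A :: "'a set set"
  assumes "infinite (UNIV :: 'a set)"
    and "finite U" and "partial_sts U A"
  shows "\<exists>V B. finite V \<and> sts V B \<and> embedded U A V B \<and>
           (\<forall>W C. proper_subsystem W C V B \<and> nontrivial W \<longrightarrow> subsystem W C U A)"
proof -
  have blk: "b \<subseteq> U" "card b = 3" if "b \<in> A" for b
    using assms(3) that unfolding partial_sts_def by auto
  have "finite A" using assms(2) blk(1) by (intro finite_subset[of A "Pow U"]) auto
  then obtain V0 B0 where V0: "finite V0" "sts V0 B0" "odd (card V0)" "21 \<le> card V0"
    "U \<subseteq> V0" "A \<subseteq> B0"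
    using embed_partial_sts[OF assms(1,2) _ assms(3)] by blast
  define m where "m = card V0"
  obtain f where f: "bij_betw f V0 {..<m}"
    using ex_bij_betw_finite_nat[OF V0(1)] by (auto simp: atLeast0LessThan m_def)
  then have inj: "inj_on f V0" and onto: "f ` V0 = {..<m}" by (auto simp: bij_betw_def)
  define A1 where "A1 = (`) f ` A"
  define Z0 where "Z0 = (`) f ` B0"
  have Z0: "sts {..<m} Z0" using sts_image[OF V0(2) inj] onto Z0_def by simp
  have m: "odd m" "3 \<le> m" using V0(3,4) by (auto simp: m_def)
  \<comment> \<open>This additional doubling makes the labelling generic, whatever \<open>Z0\<close>
    is.\<close>
  define s where "s = 2 * m + 1"
  define Z where "Z = doubling m Z0"
  have Z: "sts {..<s} Z" "odd s" "s \<ge> 3" "generic s Z"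
    unfolding s_def Z_def using sts_doubling[OF Z0 m(1)] generic_doubling[OF Z0 m] m by auto
  have "A1 \<subseteq> Z" using V0(6) unfolding A1_def Z_def Z0_def by (auto intro: doubling_oldI)
  \<comment> \<open>All blocks that do not come from \<open>A\<close> are to be removed.\<close>
  then have Z_A1: "Z - (Z - A1) = A1" by blast
  have "finite (Z - A1)" using finite_sts[OF Z(1)] by simp
  then obtain n B where n: "2 * s + 1 \<le> n" "sts {..<n} B" "A1 \<subseteq> B"
    and ctrl: "\<And>W. W \<subseteq> {..<n} \<Longrightarrow> card W > 3 \<Longrightarrow> sub_closed B W \<Longrightarrow> W \<noteq> {..<n} \<Longrightarrow>
      (\<forall>b\<in>B. b \<subseteq> W \<longrightarrow> b \<in> A1)"
    using eliminate_blocks[OF Z, of "Z - A1"] unfolding Z_A1 by auto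
  \<comment> \<open>As \<open>g\<close> undoes \<open>f\<close> on all of \<open>V0\<close>, the
    blocks of \<open>A\<close> return to themselves.\<close>
  obtain g where g: "inj_on g {..<n}" "\<And>v. v \<in> V0 \<Longrightarrow> g (f v) = v"
    using extend_inverse[OF assms(1) f] by blast
  define V where "V = g ` {..<n}"
  define B1 where "B1 = (`) g ` B"
  have B1: "sts V B1" unfolding V_def B1_def by (rule sts_image[OF n(2) g(1)])
  have "U \<subseteq> V"
  proof
    fix u assume "u \<in> U"
    then have u: "u \<in> V0" using V0(5) by blast
    then have "f u < m" using onto by blast
    then have "f u < n" "g (f u) = u" using g(2)[OF u] n(1) s_def by simp_all
    then show "u \<in> V" unfolding V_def by (metis image_eqI lessThan_iff)
  qed
  moreover have "A \<subseteq> B1"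
    unfolding B1_def using n(3)[unfolded A1_def]
    by (rule image_sts_subset[where f = f and V = V0, rotated 2]) (use blk V0(5) g(2) in auto)
  moreover have "subsystem W C U A" if "proper_subsystem W C V B1" "nontrivial W" for W C
  proof -
    have sub: "subsystem W C V B1" and "W \<noteq> V" using that unfolding proper_subsystem_def by auto
    then have C: "sts W C" "W \<subseteq> V" "C \<subseteq> B1" unfolding subsystem_def embedded_def by auto
    note closed = subsystem_closed[OF sub B1]
    define X where "X = {k. k < n \<and> g k \<in> W}"
    have gX: "g ` X = W" using C(2) unfolding X_def V_def by auto
    have X: "X \<subseteq> {..<n}" unfolding X_def by auto
    have injX: "inj_on g X" using g(1) X by (rule inj_on_subset)
    have card: "card X > 3" using that(2) card_image[OF injX] gX unfolding nontrivial_def by simp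
    have "sub_closed B X"
      unfolding sub_closed_def
    proof (intro allI impI)
      fix p q r assume b: "{p, q, r} \<in> B" "p \<in> X" "q \<in> X"
      have "{g p, g q, g r} \<in> B1" unfolding B1_def using b(1) by (intro image_eqI[of _ _ "{p, q, r}"]) auto
      from sub_closedD[OF closed this] have "g r \<in> W" using b unfolding X_def by blast
      then show "r \<in> X" using sts_distinct(6)[OF n(2) b(1)] unfolding X_def by simp
    qed
    moreover have "X \<noteq> {..<n}" using gX \<open>W \<noteq> V\<close> unfolding V_def by blast
    ultimately have in_A1: "b \<in> A1" if "b \<in> B" "b \<subseteq> X" for b using ctrl[OF X card] that by blast
    have CA: "C \<subseteq> A"
    proof
      fix e assume e: "e \<in> C"
      then obtain b where b: "b \<in> B" "e = g ` b" using C(3) unfolding B1_def by blast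
      have "b \<subseteq> X"
        using sts_block(1)[OF n(2) b(1)] sts_block(1)[OF C(1) e] b(2) unfolding X_def by blast
      then obtain h where h: "h \<in> A" "b = f ` h" using in_A1[OF b(1)] unfolding A1_def by blast
      have "g ` f ` h = h" using h(1) blk(1) V0(5) g(2) by (intro image_image_inverse) blast
      then show "e \<in> A" using h b by simp
    qed
    \<comment> \<open>Each point of \<open>W\<close> lies on a block of \<open>C\<close> with a
      second point of \<open>W\<close>, and the blocks of \<open>C\<close> are now known to be
      blocks of \<open>A\<close>.\<close>
    have "W \<subseteq> U"
    proof
      fix w assume w: "w \<in> W"
      have "W \<noteq> {w}" using that(2) unfolding nontrivial_def by auto
      then obtain v where "v \<in> W" "w \<noteq> v" using w by blast
      then obtain u where "{w, v, u} \<in> C" using sts_ex_third[OF C(1) w] by metis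
      then show "w \<in> U" using CA blk(1) by blast
    qed
    then show ?thesis using C(1) CA unfolding subsystem_def embedded_def by blast
  qed
  ultimately show ?thesis
    using B1 by (intro exI[of _ V] exI[of _ B1]) (auto simp: V_def embedded_def)
qed

end
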